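(* Let $\mathcal B$ be the collection of all balls in $\mathbb R^n$. Let $p(\cdot),q(\cdot),r(\cdot),s(\cdot),1/\alpha(\cdot)\in\mathcal P(\mathbb R^n)$ and assume that $\frac1{p(\cdot)}-\frac1{q(\cdot)}=\frac1{r(\cdot)}-\frac1{s(\cdot)}$ almost everywhere on $\mathbb R^n$. Suppose also that $$[1]_{A_{p(\cdot)}(\mathcal B)}+[1]_{A_{q(\cdot)}(\mathcal B)}+[1]_{A_{r(\cdot)}(\mathcal B)}+[1]_{A_{s(\cdot)}(\mathcal B)}+[1]_{A_{1/\alpha(\cdot)}(\mathcal B)}<\infty.$$ Then the following criteria hold. (Maximal) Assume that $M^{\alpha(\cdot)}:L^{p(\cdot)}(\mathbb R^n)\to L^{q(\cdot)}(\mathbb R^n)$ is bounded. Then $M^{\alpha(\cdot)}:\mathcal M^{r(\cdot)}_{p(\cdot)}(\mathcal B)\to\mathcal M^{s(\cdot)}_{q(\cdot)}(\mathcal B)$ is bounded if and only if $$\sup_{B\in\mathcal B}\frac{\|1_B\|_{\mathcal M^{s(\cdot)}_{q(\cdot)}(\mathcal B)}\,\|1_B\|_{(\mathcal M^{r(\cdot)}_{p(\cdot)}(\mathcal B))'}}{|B|^{1-\langle\alpha\rangle_B}}<\infty.$$ (Riesz) Assume that $I^{\alpha(\cdot)}:L^{p(\cdot)}(\mathbb R^n)\to L^{q(\cdot)}(\mathbb R^n)$ is bounded. Then $I^{\alpha(\cdot)}:\mathcal M^{r(\cdot)}_{p(\cdot)}(\mathcal B)\to\mathcal M^{s(\cdot)}_{q(\cdot)}(\mathcal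 B)$ is bounded if and only if $$\sup_{B_0\in\mathcal B}\|1_{B_0}\|_{\mathcal M^{s(\cdot)}_{q(\cdot)}(\mathcal B)}\left\|K_{B_0}^{\alpha(\cdot)}\right\|_{(\mathcal M^{r(\cdot)}_{p(\cdot)}(\mathcal B))'}<\infty,$$ where, $c_{B_0}$ being the centre of $B_0$, $$K_{B_0}^{\alpha(\cdot)}(y)=\frac{1_{\mathbb R^n\setminus 2B_0}(y)}{|y-c_{B_0}|^{n\left(1-\langle\alpha\rangle_{B(c_{B_0},|y-c_{B_0}|)}\right)}}.$$
   Context: $\mathcal{P}(\mathbb{R}^n)$ is the set of measurable functions $p(\cdot):\mathbb{R}^n\to[1,\infty]$ (Lebesgue measure). With $1/\infty=0$, $1/0=\infty$, the condition $1/\alpha(\cdot)\in\mathcal P(\mathbb R^n)$ means that $\alpha:\mathbb{R}^n\to[0,1]$ is measurable. The conjugate exponent is given by $\frac1{p(\cdot)}+\frac1{p'(\cdot)}=1$. The norm of $L^{p(\cdot)}$ is $\|f\|_{L^{p(\cdot)}}=\inf\{\lambda>0:\rho_{p(\cdot)}(f/\lambda)\le1\}$, where $\rho_{p(\cdot)}(f)=\int_{\{p(\cdot)<\infty\}}|f(x)|^{p(x)}\,dx+\|f\|_{L^\infty(\{p(\cdot)=\infty\})}$. For a ball $B$: $\langle\alpha\rangle_B=\frac1{|B|}\int_B\alpha$; the harmonic mean $t_B$ of an exponent $t(\cdot)$ is given by $\frac1{t_B}=\frac1{|B|}\int_B\frac{dx}{t(x)}$; $2B$ is the concentric dilate; and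 $[1]_{A_{t(\cdot)}(\mathcal B)}=\sup_{B\in\mathcal B}\|1_B\|_{L^{t(\cdot)}}\|1_B\|_{L^{t'(\cdot)}}/|B|$. The variable exponent Morrey space $\mathcal M^{r(\cdot)}_{p(\cdot)}(\mathcal B)$ consists of the measurable $f$ (modulo a.e. equality) with $$\|f\|_{\mathcal M^{r(\cdot)}_{p(\cdot)}(\mathcal B)}=\sup_{B\in\mathcal B}|B|^{\frac1{r_B}-\frac1{p_B}}\|1_Bf\|_{L^{p(\cdot)}}<\infty.$$ For a normed function lattice $Y$, the associate (Köthe dual) norm is $\|g\|_{Y'}=\sup_{\|f\|_Y\le1}\|fg\|_{L^1}$. The operators are $$M^{\alpha(\cdot)}f(x)=\sup_{B\in\mathcal B}\frac{1_B(x)}{|B|^{1-\langle\alpha\rangle_B}}\int_B|f(y)|\,dy,\qquad I^{\alpha(\cdot)}f(x)=\int_{\mathbb R^n\setminus\{x\}}\frac{f(y)\,dy}{|x-y|^{n(1-\langle\alpha\rangle_{B(x,|x-y|)})}}.$$ Boundedness $Z\to Y$ means $\|Tf\|_Y\le C\|f\|_Z$ for all $f\in Z$ with a finite constant $C$. *)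

theory Defs
  imports "HOL-Probability.Essential_Supremum"
begin

text \<open>
  Euclidean space of dimension \<open>n\<close> is a type \<open>'a :: euclidean_space\<close> with \<open>n = DIM('a)\<close>,
  measurability is Lebesgue measurability, and functions are complex valued.  All the norms
  below depend only on the modulus of a function, so they are given as functionals on functions
  with values in \<open>[0, \<infinity>]\<close>; the value \<open>\<infinity>\<close> of a norm means that the function is not
  in the space.
\<close>

text \<open>In \<^typ>\<open>ennreal\<close> one has \<open>inverse 0 = \<infinity>\<close> and \<open>inverse \<infinity> = 0\<close>.\<close>

definition var_exponents :: "('a::euclidean_space \<Rightarrow> ennreal) set" where
  "var_exponents = {p. p \<in> borel_measurable lebesgue \<and> (\<forall>x. 1 \<le> p x)}"

definition recip :: "ennreal \<Rightarrow> real" where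
  "recip t = enn2real (inverse t)"

text \<open>For \<open>p x \<ge> 1\<close> this is the unique solution of \<open>1 / p x + 1 / p' x = 1\<close>.\<close>

definition conj_exponent :: "('a \<Rightarrow> ennreal) \<Rightarrow> 'a \<Rightarrow> ennreal" where
  "conj_exponent p x = inverse (1 - inverse (p x))"

definition balls :: "'a::euclidean_space set set" where
  "balls = {ball c R | c R. 0 < R}"

abbreviation vol :: "'a::euclidean_space set \<Rightarrow> real" where
  "vol B \<equiv> measure lebesgue B"

definition average :: "('a::euclidean_space \<Rightarrow> real) \<Rightarrow> 'a set \<Rightarrow> real" where
  "average g B = (LINT x:B|lebesgue. g x) / vol B"

definition harmonic_mean :: "('a::euclidean_space \<Rightarrow> ennreal) \<Rightarrow> 'a set \<Rightarrow> ennreal" where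
  "harmonic_mean t B = inverse ((\<integral>\<^sup>+x\<in>B. inverse (t x) \<partial>lebesgue) / emeasure lebesgue B)"

text \<open>Power of an extended nonnegative number with a real exponent \<open>a > 0\<close>.\<close>

definition epowr :: "ennreal \<Rightarrow> real \<Rightarrow> ennreal" where
  "epowr u a = (if u = \<infinity> then \<infinity> else ennreal (enn2real u powr a))"

definition modular :: "('a::euclidean_space \<Rightarrow> ennreal) \<Rightarrow> ('a \<Rightarrow> ennreal) \<Rightarrow> ennreal" where
  "modular p f =
     (\<integral>\<^sup>+x\<in>{x. p x < \<infinity>}. epowr (f x) (enn2real (p x)) \<partial>lebesgue)
     + esssup (lebesgue_on {x. p x = \<infinity>}) f"

definition Lp_norm :: "('a::euclidean_space \<Rightarrow> ennreal) \<Rightarrow> ('a \<Rightarrow> ennreal) \<Rightarrow> ennreal" where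
  "Lp_norm p f = (INF l\<in>{l::real. 0 < l \<and> modular p (\<lambda>x. f x / ennreal l) \<le> 1}. ennreal l)"

definition A_const :: "('a::euclidean_space \<Rightarrow> ennreal) \<Rightarrow> ennreal" where
  "A_const t =
     (SUP B\<in>balls. Lp_norm t (indicator B) * Lp_norm (conj_exponent t) (indicator B)
                     / emeasure lebesgue B)"

text \<open>\<open>morrey_norm r p\<close> has integrability exponent \<open>p\<close> (subscript) and Morrey exponent \<open>r\<close>
  (superscript).\<close>

definition morrey_norm ::
    "('a::euclidean_space \<Rightarrow> ennreal) \<Rightarrow> ('a \<Rightarrow> ennreal) \<Rightarrow> ('a \<Rightarrow> ennreal) \<Rightarrow> ennreal" where
  "morrey_norm r p f =
     (SUP B\<in>balls. ennreal (vol B powr (recip (harmonic_mean r B) - recip (harmonic_mean p B)))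
                     * Lp_norm p (\<lambda>x. indicator B x * f x))"

definition associate_norm ::
    "(('a::euclidean_space \<Rightarrow> ennreal) \<Rightarrow> ennreal) \<Rightarrow> ('a \<Rightarrow> ennreal) \<Rightarrow> ennreal" where
  "associate_norm Y g =
     (SUP f\<in>{f. f \<in> borel_measurable lebesgue \<and> Y f \<le> 1}. \<integral>\<^sup>+x. f x * g x \<partial>lebesgue)"

abbreviation modulus :: "('a \<Rightarrow> complex) \<Rightarrow> 'a \<Rightarrow> ennreal" where
  "modulus f \<equiv> \<lambda>x. ennreal (norm (f x))"

definition maximal_op ::
    "('a::euclidean_space \<Rightarrow> real) \<Rightarrow> ('a \<Rightarrow> complex) \<Rightarrow> 'a \<Rightarrow> ennreal" where
  "maximal_op \<alpha> f x =
     (SUP B\<in>balls. indicator B x / ennreal (vol B powr (1 - average \<alpha> B))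
                     * (\<integral>\<^sup>+y\<in>B. modulus f y \<partial>lebesgue))"

definition riesz_kernel :: "('a::euclidean_space \<Rightarrow> real) \<Rightarrow> 'a \<Rightarrow> 'a \<Rightarrow> real" where
  "riesz_kernel \<alpha> x y =
     1 / norm (x - y) powr (real DIM('a) * (1 - average \<alpha> (ball x (norm (x - y)))))"

definition riesz_potential ::
    "('a::euclidean_space \<Rightarrow> real) \<Rightarrow> ('a \<Rightarrow> complex) \<Rightarrow> 'a \<Rightarrow> complex" where
  "riesz_potential \<alpha> f x = (LINT y:UNIV - {x}|lebesgue. riesz_kernel \<alpha> x y *\<^sub>R f y)"

text \<open>The modulus of the Riesz potential.  The Bochner integral of a non-integrable function is
  \<open>0\<close> by convention; where the integral defining the potential does not converge absolutely, the
  modulus is set to \<open>\<infinity>\<close> instead.  Hence finiteness of a norm of this function entails that the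
  potential is well defined almost everywhere.\<close>

definition riesz_op ::
    "('a::euclidean_space \<Rightarrow> real) \<Rightarrow> ('a \<Rightarrow> complex) \<Rightarrow> 'a \<Rightarrow> ennreal" where
  "riesz_op \<alpha> f x =
     (if set_integrable lebesgue (UNIV - {x}) (\<lambda>y. riesz_kernel \<alpha> x y *\<^sub>R f y)
      then ennreal (norm (riesz_potential \<alpha> f x)) else \<infinity>)"

text \<open>Boundedness from \<open>Z\<close> to \<open>Y\<close> of an operator, where \<open>T f\<close> is the modulus of the image
  of \<open>f\<close>.\<close>

definition bounded_op ::
    "(('a::euclidean_space \<Rightarrow> ennreal) \<Rightarrow> ennreal) \<Rightarrow> (('a \<Rightarrow> ennreal) \<Rightarrow> ennreal)
      \<Rightarrow> (('a \<Rightarrow> complex) \<Rightarrow> 'a \<Rightarrow> ennreal) \<Rightarrow> bool" where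
  "bounded_op Z Y T \<longleftrightarrow>
     (\<exists>C::real. \<forall>f\<in>borel_measurable lebesgue.
        Z (modulus f) < \<infinity> \<longrightarrow> Y (T f) \<le> ennreal C * Z (modulus f))"

text \<open>The kernel associated with the ball of centre \<open>c\<close> and radius \<open>R\<close>.\<close>

definition ball_kernel ::
    "('a::euclidean_space \<Rightarrow> real) \<Rightarrow> 'a \<Rightarrow> real \<Rightarrow> 'a \<Rightarrow> ennreal" where
  "ball_kernel \<alpha> c R y = indicator (UNIV - ball c (2 * R)) y * ennreal (riesz_kernel \<alpha> c y)"

end

theory Submission
  imports Defs
begin

text \<open>
  The proof rests on one fact about an exponent \<open>t\<close> with finite Muckenhoupt constant: the number \<open>|B|\<close> to the
  power \<open>1/t\<^sub>B\<close> changes by at most a bounded factor when a ball is replaced by a larger ball of comparable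
  radius (\<open>harmonic_volume_comparable\<close>), and so does the analogous number for the conjugate exponent.
  This follows from the inequality \<open>|B|\<close> to the power \<open>1/t\<^sub>B \<le> e \<parallel>1\<^sub>B\<parallel>\<close> (\<open>harmonic_volume_le_Lp_norm\<close>), which is
  Jensen's inequality and holds for every exponent: applied to \<open>t\<close> on one ball and to \<open>t'\<close> on the other,
  it bounds the product of the two numbers by the Muckenhoupt product of the larger ball.

  For \<open>t = p\<close> and \<open>t = r\<close> it follows that the Morrey weights of \<open>B\<close> and \<open>2B\<close> are comparable.  The relation
  between the four exponents says that \<open>B\<close> has the same weight in the two Morrey spaces.  For \<open>t = 1/\<alpha>\<close> it
  follows that the normalising factors of the averages in the maximal operator, and the values of the Riesz
  kernel at distant points, are comparable for comparable balls.

  Sufficiency.  On a ball \<open>B\<close> split \<open>f\<close> into the parts inside and outside \<open>2B\<close>.  The inner part is handled by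
  the boundedness of the operator on the Lebesgue spaces and the comparison of weights.  The outer part
  contributes at most a constant on \<open>B\<close>, which duality and the testing condition bound by a multiple of
  \<open>\<parallel>f\<parallel> / \<parallel>1\<^sub>B\<parallel>\<close> in Morrey norms (\<open>maximal_local_estimate\<close>, \<open>riesz_local_estimate\<close>); a constant of this size has
  a Morrey norm on \<open>B\<close> of at most a multiple of \<open>\<parallel>f\<parallel>\<close>.  Both cases are then finished by
  \<open>morrey_bounded_if_local_estimate\<close>.

  Necessity.  For \<open>f \<ge> 0\<close> the operator dominates, at every point of a ball, the pairing of \<open>f\<close> with the function
  whose associate norm occurs in the testing condition; \<open>testing_condition_if_bounded\<close> turns this
  pointwise bound into the condition.
\<close>

section \<open>Luxemburg norms with variable exponent\<close>

lemma epowr_mono: "u \<le> v \<Longrightarrow> 0 \<le> a \<Longrightarrow> epowr u a \<le> epowr v a"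
  by (cases u; cases v) (auto simp: epowr_def intro!: ennreal_leI powr_mono2 simp: top_unique)

text \<open>Exponents are at least \<open>1\<close>, so halving the argument at least halves the power.  This is the only
  form of convexity of the modular needed to obtain a quasi-triangle inequality.\<close>

lemma epowr_half:
  assumes "1 \<le> a"
  shows "epowr (u / 2) a \<le> epowr u a / 2"
proof (cases u)
  case (real t)
  have "(2::real) powr 1 \<le> 2 powr a"
    using assms by (intro powr_mono) auto
  then have "t powr a / 2 powr a \<le> t powr a / 2"
    by (intro divide_left_mono) auto
  then have "(t / 2) powr a \<le> t powr a / 2"
    using real by (simp add: powr_divide)
  then show ?thesis
    using real by (simp add: epowr_def ennreal_divide_numeral ennreal_leI)
next
  case top
  then show ?thesis by (simp add: epowr_def ennreal_top_divide)
qed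

lemma epowr_measurable [measurable]:
  "f \<in> borel_measurable M \<Longrightarrow> g \<in> borel_measurable M \<Longrightarrow> (\<lambda>x. epowr (f x) (g x)) \<in> borel_measurable M"
  unfolding epowr_def by (intro measurable_If) auto

lemma average_quarter_le_half_max: "(u + v) / 4 \<le> (max u v :: ennreal) / 2"
proof -
  have "(u + v) / 4 \<le> (2 * max u v) / 4"
    by (intro divide_right_mono_ennreal) (auto simp: mult_2 intro!: add_mono)
  also have "\<dots> = max u v / 2"
    by (cases "max u v") (auto simp: ennreal_mult_top ennreal_top_divide ennreal_divide_numeral ennreal_mult[symmetric]
        simp flip: ennreal_numeral simp: divide_ennreal)
  finally show ?thesis .
qed

lemma ennreal_inverse_antimono: "a \<le> b \<Longrightarrow> inverse b \<le> inverse (a :: ennreal)"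
  by (cases a; cases b; cases "a = 0") (auto simp: inverse_ennreal top_unique intro!: ennreal_leI le_imp_inverse_le)

lemma ennreal_cmult_div:
  assumes "0 < c" "0 < l"
  shows "ennreal c * u / ennreal l = u / ennreal (l / c)"
  using assms
  by (cases u) (simp_all add: ennreal_mult[symmetric] divide_ennreal ennreal_mult_top ennreal_top_divide mult.commute)

text \<open>The hypotheses are asymmetric because the integral is monotone for arbitrary functions, and the essential
  supremum of a function \<open>g\<close> that is not measurable on \<open>{x. p x = \<infinity>}\<close> is \<open>\<infinity>\<close> by convention.\<close>

lemma modular_mono:
  assumes "f \<in> borel_measurable lebesgue" "\<And>x. f x \<le> g x"
  shows "modular p f \<le> modular p g"
  unfolding modular_def
proof (intro add_mono nn_integral_mono esssup_mono)
  show "epowr (f x) (enn2real (p x)) * indicator {x. p x < \<infinity>} x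
      \<le> epowr (g x) (enn2real (p x)) * indicator {x. p x < \<infinity>} x" for x
    using assms(2) by (auto intro!: mult_right_mono epowr_mono)
qed (use assms in \<open>auto intro: measurable_restrict_space1\<close>)

text \<open>A quarter of a sum is at most half the maximum, the half comes out of the modular, and the modular of
  a maximum is at most the sum of the modulars.\<close>

lemma modular_add_quarter:
  assumes p: "p \<in> var_exponents"
    and [measurable]: "f \<in> borel_measurable lebesgue" "g \<in> borel_measurable lebesgue"
  shows "modular p (\<lambda>x. (f x + g x) / 4) \<le> (modular p f + modular p g) / 2"
proof -
  have [measurable]: "p \<in> borel_measurable lebesgue"
    using p by (auto simp: var_exponents_def)
  let ?i = "\<lambda>x. indicator {x. p x < \<infinity>} x :: ennreal"
  let ?N = "lebesgue_on {x. p x = \<infinity>}"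
  have *: "epowr ((f x + g x) / 4) (enn2real (p x)) * ?i x
     \<le> (epowr (f x) (enn2real (p x)) * ?i x + epowr (g x) (enn2real (p x)) * ?i x) / 2" for x
  proof (cases "p x < \<infinity>")
    case True
    then have 1: "1 \<le> enn2real (p x)"
      using p ennreal_le_iff[of "enn2real (p x)" 1]
      by (metis (mono_tags, lifting) True enn2real_1 enn2real_mono infinity_ennreal_def mem_Collect_eq var_exponents_def)
    have "epowr ((f x + g x) / 4) (enn2real (p x)) \<le> epowr (max (f x) (g x) / 2) (enn2real (p x))"
      by (intro epowr_mono average_quarter_le_half_max) auto
    also have "\<dots> \<le> epowr (max (f x) (g x)) (enn2real (p x)) / 2"
      by (rule epowr_half[OF 1])
    also have "\<dots> \<le> (epowr (f x) (enn2real (p x)) + epowr (g x) (enn2real (p x))) / 2"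
      by (intro divide_right_mono_ennreal) (auto simp: max_def)
    finally show ?thesis using True by simp
  qed auto
  have "(\<integral>\<^sup>+x. epowr ((f x + g x) / 4) (enn2real (p x)) * ?i x \<partial>lebesgue)
     \<le> (\<integral>\<^sup>+x. (epowr (f x) (enn2real (p x)) * ?i x + epowr (g x) (enn2real (p x)) * ?i x) / 2 \<partial>lebesgue)"
    by (rule nn_integral_mono) (rule *)
  also have "\<dots> = ((\<integral>\<^sup>+x. epowr (f x) (enn2real (p x)) * ?i x \<partial>lebesgue)
        + (\<integral>\<^sup>+x. epowr (g x) (enn2real (p x)) * ?i x \<partial>lebesgue)) / 2"
    by (subst nn_integral_divide, measurable, subst nn_integral_add, measurable)
  finally have 1: "(\<integral>\<^sup>+x. epowr ((f x + g x) / 4) (enn2real (p x)) * ?i x \<partial>lebesgue) \<le> \<dots>" .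
  have ff: "f \<in> borel_measurable ?N" "g \<in> borel_measurable ?N"
    by (auto intro: measurable_restrict_space1)
  have "AE x in ?N. (f x + g x) / 4 \<le> (esssup ?N f + esssup ?N g) / 2"
    using esssup_AE[of f ?N] esssup_AE[of g ?N]
  proof eventually_elim
    case (elim x)
    have "(f x + g x) / 4 \<le> (f x + g x) / 2"
      unfolding divide_ennreal_def by (intro mult_left_mono ennreal_inverse_antimono) auto
    also have "\<dots> \<le> (esssup ?N f + esssup ?N g) / 2"
      using elim by (intro divide_right_mono_ennreal add_mono)
    finally show ?case .
  qed
  then have 2: "esssup ?N (\<lambda>x. (f x + g x) / 4) \<le> (esssup ?N f + esssup ?N g) / 2"
    using ff by (intro esssup_I) auto
  show ?thesis
    unfolding modular_def using add_mono[OF 1 2] by (simp add: add_divide_distrib_ennreal ac_simps)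
qed

lemma Lp_norm_mono:
  assumes [measurable]: "f \<in> borel_measurable lebesgue" and le: "\<And>x. f x \<le> g x"
  shows "Lp_norm p f \<le> Lp_norm p g"
  unfolding Lp_norm_def
proof (intro INF_superset_mono subsetI)
  fix l assume "l \<in> {l. 0 < l \<and> modular p (\<lambda>x. g x / ennreal l) \<le> 1}"
  moreover have "modular p (\<lambda>x. f x / ennreal l) \<le> modular p (\<lambda>x. g x / ennreal l)"
    using le by (intro modular_mono divide_right_mono_ennreal) auto
  ultimately show "l \<in> {l. 0 < l \<and> modular p (\<lambda>x. f x / ennreal l) \<le> 1}"
    by auto
qed auto

lemma Lp_norm_le: "0 < l \<Longrightarrow> modular p (\<lambda>x. f x / ennreal l) \<le> 1 \<Longrightarrow> Lp_norm p f \<le> ennreal l"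
  unfolding Lp_norm_def by (rule INF_lower) auto

lemma Lp_norm_cmult_ge:
  assumes "0 < c"
  shows "ennreal c * Lp_norm p f \<le> Lp_norm p (\<lambda>x. ennreal c * f x)"
  unfolding Lp_norm_def[of p "\<lambda>x. ennreal c * f x"]
proof (rule INF_greatest)
  fix l :: real assume l: "l \<in> {l. 0 < l \<and> modular p (\<lambda>x. ennreal c * f x / ennreal l) \<le> 1}"
  then have "Lp_norm p f \<le> ennreal (l / c)"
    using assms by (intro Lp_norm_le) (auto simp: ennreal_cmult_div)
  then have "ennreal c * Lp_norm p f \<le> ennreal c * ennreal (l / c)"
    by (intro mult_left_mono) auto
  also have "\<dots> = ennreal l"
    using assms l by (simp add: ennreal_mult[symmetric])
  finally show "ennreal c * Lp_norm p f \<le> ennreal l" .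
qed

lemma ennreal_mult_inverse_cancel:
  assumes "0 < c"
  shows "ennreal (1 / c) * (ennreal c * x) = x" "ennreal c * (ennreal (1 / c) * x) = x"
proof -
  have "ennreal (1 / c) * ennreal c = 1"
    using assms by (subst ennreal_mult[symmetric]) auto
  then show "ennreal (1 / c) * (ennreal c * x) = x" "ennreal c * (ennreal (1 / c) * x) = x"
    by (metis mult.assoc mult.commute mult.left_neutral)+
qed

lemma Lp_norm_cmult:
  assumes "0 < c"
  shows "Lp_norm p (\<lambda>x. ennreal c * f x) = ennreal c * Lp_norm p f"
proof (rule antisym)
  have "ennreal (1 / c) * Lp_norm p (\<lambda>x. ennreal c * f x) \<le> Lp_norm p f"
    using Lp_norm_cmult_ge[of "1 / c" p "\<lambda>x. ennreal c * f x"] assms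
    by (simp add: ennreal_mult_inverse_cancel)
  then have "ennreal c * (ennreal (1 / c) * Lp_norm p (\<lambda>x. ennreal c * f x)) \<le> ennreal c * Lp_norm p f"
    by (intro mult_left_mono) auto
  then show "Lp_norm p (\<lambda>x. ennreal c * f x) \<le> ennreal c * Lp_norm p f"
    using assms by (simp add: ennreal_mult_inverse_cancel)
qed (rule Lp_norm_cmult_ge[OF assms])

lemma modular_le_1_if_Lp_norm_less:
  assumes [measurable]: "f \<in> borel_measurable lebesgue" and less: "Lp_norm p f < ennreal l"
  shows "modular p (\<lambda>x. f x / ennreal l) \<le> 1"
proof -
  obtain k where k: "0 < k" "modular p (\<lambda>x. f x / ennreal k) \<le> 1" "ennreal k < ennreal l"
    using less by (auto simp: Lp_norm_def INF_less_iff)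
  have "modular p (\<lambda>x. f x / ennreal l) \<le> modular p (\<lambda>x. f x / ennreal k)"
    using k unfolding divide_ennreal_def
    by (intro modular_mono mult_left_mono ennreal_inverse_antimono) auto
  with k show ?thesis by auto
qed

text \<open>The sharp constant is \<open>1\<close>; the constant \<open>4\<close> comes from comparing the sum with the maximum of the two
  functions, which avoids a convexity argument for the powers.\<close>

lemma Lp_norm_add:
  assumes p: "p \<in> var_exponents"
    and [measurable]: "f \<in> borel_measurable lebesgue" "g \<in> borel_measurable lebesgue"
  shows "Lp_norm p (\<lambda>x. f x + g x) \<le> 4 * (Lp_norm p f + Lp_norm p g)"
proof (cases "Lp_norm p f + Lp_norm p g < \<infinity>")
  case True
  then obtain a where a: "Lp_norm p f + Lp_norm p g = ennreal a" "0 \<le> a"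
    by (cases "Lp_norm p f + Lp_norm p g") auto
  have le: "Lp_norm p f \<le> ennreal a" "Lp_norm p g \<le> ennreal a"
    unfolding a(1)[symmetric] by auto
  show ?thesis
  proof (rule ennreal_le_epsilon)
    fix e :: real assume "0 < e"
    define l where "l = a + e / 4"
    have l: "0 < l" "ennreal a < ennreal l"
      using a \<open>0 < e\<close> by (auto simp: l_def ennreal_less_iff)
    have *: "modular p (\<lambda>x. f x / ennreal l) \<le> 1" "modular p (\<lambda>x. g x / ennreal l) \<le> 1"
      using le l(2) by (auto intro!: modular_le_1_if_Lp_norm_less)
    have "modular p (\<lambda>x. (f x + g x) / ennreal (4 * l)) = modular p (\<lambda>x. (f x / ennreal l + g x / ennreal l) / 4)"
      using l(1) by (simp add: add_divide_distrib_ennreal[symmetric] divide_ennreal_def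
        ennreal_mult ennreal_inverse_mult distrib_left distrib_right ac_simps)
    also have "\<dots> \<le> (modular p (\<lambda>x. f x / ennreal l) + modular p (\<lambda>x. g x / ennreal l)) / 2"
      by (intro modular_add_quarter p) auto
    also have "\<dots> \<le> (1 + 1) / 2"
      by (intro divide_right_mono_ennreal add_mono *)
    also have "\<dots> = 1" by simp
    finally have "Lp_norm p (\<lambda>x. f x + g x) \<le> ennreal (4 * l)"
      using l by (intro Lp_norm_le) auto
    also have "4 * l = 4 * a + e" by (simp add: l_def)
    also have "ennreal (4 * a + e) = 4 * (Lp_norm p f + Lp_norm p g) + ennreal e"
      using a(2) \<open>0 < e\<close> unfolding a(1) by (simp add: ennreal_mult)
    finally show "Lp_norm p (\<lambda>x. f x + g x) \<le> 4 * (Lp_norm p f + Lp_norm p g) + ennreal e" .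
  qed
qed (auto simp: ennreal_mult_top top.not_eq_extremum[symmetric])

lemma Lp_norm_zero: "Lp_norm p (\<lambda>x. 0) = 0"
proof -
  have "modular p (\<lambda>x. 0) = 0"
    by (simp add: modular_def epowr_def esssup_I[of "\<lambda>x. 0" _ "0 :: ennreal", simplified])
  then have "Lp_norm p (\<lambda>x. 0) \<le> ennreal e" if "0 < e" for e
    using that by (intro Lp_norm_le) auto
  then have "Lp_norm p (\<lambda>x. 0) \<le> 0"
    by - (rule ennreal_le_epsilon, auto)
  then show ?thesis by simp
qed

lemma Lp_norm_cmult_le: "0 \<le> c \<Longrightarrow> Lp_norm p (\<lambda>x. ennreal c * f x) \<le> ennreal c * Lp_norm p f"
  using Lp_norm_cmult[of c p f] by (cases "c = 0") (auto simp: Lp_norm_zero)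

section \<open>Averages, harmonic means and conjugate exponents\<close>

lemma vol_ball: "0 < R \<Longrightarrow> vol (ball (c :: 'a::euclidean_space) R) = unit_ball_vol (real DIM('a)) * R ^ DIM('a)"
  by (simp add: content_ball)

lemma vol_ball_pos: "0 < R \<Longrightarrow> 0 < vol (ball (c :: 'a::euclidean_space) R)"
  by simp

lemma emeasure_ball_eq_vol: "emeasure lebesgue (ball (c :: 'a::euclidean_space) R) = ennreal (vol (ball c R))"
  using emeasure_lborel_ball_finite[of c R] by (intro emeasure_eq_ennreal_measure) (simp add: less_top)

lemma ball_in_sets_lebesgue [measurable]: "ball c R \<in> sets (lebesgue :: 'a::euclidean_space measure)"
  by simp

lemma indicator_ball_measurable [measurable]:
  "indicator (ball c R) \<in> borel_measurable (lebesgue :: 'a::euclidean_space measure)"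
  by (rule borel_measurable_indicator) simp

lemma integrable_indicator_ball: "integrable lebesgue (indicator (ball (c :: 'a::euclidean_space) R) :: 'a \<Rightarrow> real)"
  by (rule integrable_real_indicator) (simp_all add: emeasure_ball_eq_vol del: emeasure_completion)

lemma ennreal_inverse_inverse: "inverse (inverse x) = (x :: ennreal)"
proof (cases x)
  case (real r)
  then show ?thesis by (cases "r = 0") (auto simp: inverse_ennreal)
qed simp

lemma ennreal_add_leD: "a + b \<le> c \<Longrightarrow> a \<le> c" "a + b \<le> c \<Longrightarrow> b \<le> (c :: ennreal)"
  by (auto elim: order_trans[rotated] intro: add_increasing add_increasing2)

lemma inverse_exponent:
  assumes "t \<in> var_exponents"
  shows "inverse (t x) = ennreal (recip (t x))" "0 \<le> recip (t x)" "recip (t x) \<le> 1"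
proof -
  have "inverse (t x) \<le> inverse 1"
    using assms by (intro ennreal_inverse_antimono) (auto simp: var_exponents_def)
  then have le: "inverse (t x) \<le> 1" by simp
  then have "inverse (t x) < top"
    by (rule order_le_less_trans) simp
  then show eq: "inverse (t x) = ennreal (recip (t x))"
    by (simp add: recip_def)
  show "0 \<le> recip (t x)" by (simp add: recip_def)
  show "recip (t x) \<le> 1"
    using le unfolding eq by simp
qed

lemma recip_measurable [measurable (raw)]:
  "f \<in> borel_measurable M \<Longrightarrow> (\<lambda>x. recip (f x)) \<in> borel_measurable M"
  unfolding recip_def by measurable

lemma conj_exponent_in_var_exponents:
  assumes "t \<in> var_exponents"
  shows "conj_exponent t \<in> var_exponents"
proof -
  have [measurable]: "t \<in> borel_measurable lebesgue"
    using assms by (simp add: var_exponents_def)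
  have "inverse 1 \<le> inverse (1 - inverse (t x))" for x
    by (intro ennreal_inverse_antimono diff_le_self_ennreal)
  then show ?thesis
    by (auto simp: var_exponents_def conj_exponent_def[abs_def])
qed

lemma recip_conj_exponent:
  assumes "t \<in> var_exponents"
  shows "recip (conj_exponent t x) = 1 - recip (t x)"
  using inverse_exponent[OF assms, of x]
  by (simp add: conj_exponent_def recip_def[of "inverse _"] ennreal_inverse_inverse ennreal_minus flip: ennreal_1)

lemma integrable_on_ball:
  fixes u :: "'a::euclidean_space \<Rightarrow> real"
  assumes [measurable]: "u \<in> borel_measurable lebesgue" and "\<And>x. 0 \<le> u x" "\<And>x. u x \<le> 1"
  shows "set_integrable lebesgue (ball c R) u"
  unfolding set_integrable_def
proof (rule Bochner_Integration.integrable_bound)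
  show "integrable lebesgue (indicator (ball c R) :: 'a \<Rightarrow> real)"
    by (rule integrable_indicator_ball)
  show "(\<lambda>x. indicator (ball c R) x *\<^sub>R u x) \<in> borel_measurable lebesgue"
    by measurable
qed (use assms in \<open>auto simp: indicator_def\<close>)

lemma average_one_minus:
  fixes u :: "'a::euclidean_space \<Rightarrow> real"
  assumes "u \<in> borel_measurable lebesgue" and "\<And>x. 0 \<le> u x" "\<And>x. u x \<le> 1" and "0 < R"
  shows "average (\<lambda>x. 1 - u x) (ball c R) = 1 - average u (ball c R)"
proof -
  have "(LINT x:ball c R|lebesgue. 1 - u x) = (LINT x:ball c R|lebesgue. 1) - (LINT x:ball c R|lebesgue. u x)"
    by (intro set_integral_diff(2) integrable_on_ball assms) auto
  also have "(LINT x:ball c R|lebesgue. 1) = vol (ball c R)"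
    by (simp add: set_lebesgue_integral_def)
  finally show ?thesis
    using vol_ball_pos[OF \<open>0 < R\<close>, of c] by (simp add: average_def diff_divide_distrib)
qed

lemma average_bounds:
  fixes u :: "'a::euclidean_space \<Rightarrow> real"
  assumes [measurable]: "u \<in> borel_measurable lebesgue" and "\<And>x. 0 \<le> u x" "\<And>x. u x \<le> 1" and "0 < R"
  shows "0 \<le> average u (ball c R)" "average u (ball c R) \<le> 1"
proof -
  have nn: "0 \<le> average v (ball c R)" if "\<And>x. 0 \<le> v x" for v :: "'a \<Rightarrow> real"
    unfolding average_def set_lebesgue_integral_def
    using that by (intro divide_nonneg_nonneg integral_nonneg_AE) auto
  show "0 \<le> average u (ball c R)" by (rule nn) fact
  show "average u (ball c R) \<le> 1"
    using nn[of "\<lambda>x. 1 - u x"] assms by (simp add: average_one_minus)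
qed

lemma recip_harmonic_mean:
  fixes t :: "'a::euclidean_space \<Rightarrow> ennreal"
  assumes t: "t \<in> var_exponents" and "0 < R"
  shows "recip (harmonic_mean t (ball c R)) = average (\<lambda>x. recip (t x)) (ball c R)"
proof -
  have [measurable]: "t \<in> borel_measurable lebesgue"
    using t by (simp add: var_exponents_def)
  let ?B = "ball c R"
  have int: "set_integrable lebesgue ?B (\<lambda>x. recip (t x))"
    by (intro integrable_on_ball) (auto simp: inverse_exponent[OF t])
  have "(\<integral>\<^sup>+x\<in>?B. inverse (t x) \<partial>lebesgue) = (\<integral>\<^sup>+x. ennreal (indicator ?B x *\<^sub>R recip (t x)) \<partial>lebesgue)"
    by (intro nn_integral_cong) (auto simp: inverse_exponent[OF t] indicator_def)
  also have "\<dots> = ennreal (LINT x:?B|lebesgue. recip (t x))"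
    using int unfolding set_integrable_def set_lebesgue_integral_def
    by (intro nn_integral_eq_integral) (auto simp: inverse_exponent[OF t])
  finally have eq: "(\<integral>\<^sup>+x\<in>?B. inverse (t x) \<partial>lebesgue) = ennreal (LINT x:?B|lebesgue. recip (t x))" .
  have "0 \<le> (LINT x:?B|lebesgue. recip (t x))"
    unfolding set_lebesgue_integral_def
    by (intro integral_nonneg_AE) (auto simp: inverse_exponent[OF t])
  then have "(\<integral>\<^sup>+x\<in>?B. inverse (t x) \<partial>lebesgue) / emeasure lebesgue ?B
      = ennreal (average (\<lambda>x. recip (t x)) ?B)"
    unfolding eq emeasure_ball_eq_vol average_def using vol_ball_pos[OF \<open>0 < R\<close>]
    by (rule divide_ennreal)
  moreover have "0 \<le> average (\<lambda>x. recip (t x)) ?B"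
    using \<open>0 < R\<close> by (intro average_bounds) (auto simp: inverse_exponent[OF t])
  ultimately show ?thesis
    by (simp add: harmonic_mean_def recip_def[of "inverse _"] ennreal_inverse_inverse)
qed

section \<open>Volumes raised to harmonic mean exponents\<close>

text \<open>This is \<open>|B|\<close> to the power \<open>1/t\<^sub>B\<close>, where \<open>t\<^sub>B\<close> is the harmonic mean of \<open>t\<close> over \<open>B\<close>.  The weight in
  a Morrey norm is a quotient of two such numbers, and the normalisation in the fractional operators is
  the one belonging to the exponent conjugate to \<open>1/\<alpha>\<close>.\<close>

definition harmonic_volume :: "('a::euclidean_space \<Rightarrow> ennreal) \<Rightarrow> 'a set \<Rightarrow> real" where
  "harmonic_volume t B = vol B powr average (\<lambda>x. recip (t x)) B"

lemma harmonic_volume_pos: "0 < R \<Longrightarrow> 0 < harmonic_volume t (ball c R)"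
  by (simp add: harmonic_volume_def)

lemma harmonic_volume_conj:
  fixes t :: "'a::euclidean_space \<Rightarrow> ennreal"
  assumes t: "t \<in> var_exponents" and R: "0 < R"
  shows "harmonic_volume (conj_exponent t) (ball c R) = vol (ball c R) powr (1 - average (\<lambda>x. recip (t x)) (ball c R))"
    and "harmonic_volume t (ball c R) * harmonic_volume (conj_exponent t) (ball c R) = vol (ball c R)"
proof -
  have [measurable]: "t \<in> borel_measurable lebesgue"
    using t by (simp add: var_exponents_def)
  have "average (\<lambda>x. 1 - recip (t x)) (ball c R) = 1 - average (\<lambda>x. recip (t x)) (ball c R)"
    using R by (intro average_one_minus) (auto simp: inverse_exponent[OF t])
  then show *: "harmonic_volume (conj_exponent t) (ball c R) = vol (ball c R) powr (1 - average (\<lambda>x. recip (t x)) (ball c R))"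
    by (simp add: harmonic_volume_def recip_conj_exponent[OF t])
  show "harmonic_volume t (ball c R) * harmonic_volume (conj_exponent t) (ball c R) = vol (ball c R)"
    unfolding * unfolding harmonic_volume_def using R by (simp add: powr_add[symmetric])
qed

text \<open>A form of Jensen's inequality.  If \<open>l\<close> is admissible for the norm, then at points of \<open>B\<close> where
  \<open>t\<close> is finite, \<open>ln z \<le> z\<close> for \<open>z = |B| (1/l)\<close> to the power \<open>t\<close> bounds \<open>(1/t) ln |B| - ln l\<close> by \<open>z\<close>; where
  \<open>t = \<infinity>\<close> the left side is \<open>- ln l\<close>, and \<open>l \<ge> 1\<close> almost everywhere there.  The integral of \<open>z\<close> is at most
  \<open>|B|\<close>, so averaging over \<open>B\<close> gives \<open>(1/t\<^sub>B) ln |B| - ln l \<le> 1\<close>.\<close>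

lemma harmonic_volume_le_Lp_norm:
  fixes t :: "'a::euclidean_space \<Rightarrow> ennreal"
  assumes t: "t \<in> var_exponents" and R: "0 < R"
  shows "ennreal (harmonic_volume t (ball c R)) \<le> ennreal (exp 1) * Lp_norm t (indicator (ball c R))"
proof -
  have t_m [measurable]: "t \<in> borel_measurable lebesgue"
    using t by (simp add: var_exponents_def)
  let ?B = "ball c R"
  define V where "V = vol ?B"
  define u where "u x = recip (t x)" for x
  have V: "0 < V" using R by (simp add: V_def)
  have u: "0 \<le> u x" "u x \<le> 1" for x
    by (simp_all add: u_def inverse_exponent[OF t])
  have u_m [measurable]: "u \<in> borel_measurable lebesgue"
    unfolding u_def[abs_def] by measurable
  have main: "harmonic_volume t ?B \<le> exp 1 * l" if l: "0 < l" "modular t (\<lambda>x. indicator ?B x / ennreal l) \<le> 1" for l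
  proof -
    \<comment> \<open>The integrand of the modular on \<open>B\<close> where \<open>t\<close> is finite, as a real function.\<close>
    define h where "h x = indicator ?B x * indicator {x. t x < \<infinity>} x * (1 / l) powr enn2real (t x)" for x
    have h_m [measurable]: "h \<in> borel_measurable lebesgue"
      unfolding h_def[abs_def] by measurable
    have h_nn: "0 \<le> h x" for x by (simp add: h_def)
    have "(\<integral>\<^sup>+x. ennreal (h x) \<partial>lebesgue)
        \<le> (\<integral>\<^sup>+x\<in>{x. t x < \<infinity>}. epowr (indicator ?B x / ennreal l) (enn2real (t x)) \<partial>lebesgue)"
    proof (rule nn_integral_mono)
      fix x
      have "1 / ennreal l = ennreal (1 / l)"
        using l(1) divide_ennreal[of 1 l] by simp
      then show "ennreal (h x) \<le> epowr (indicator ?B x / ennreal l) (enn2real (t x)) * indicator {x. t x < \<infinity>} x"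
        using l(1) by (auto simp: h_def indicator_def epowr_def)
    qed
    also have "\<dots> \<le> 1"
      using l(2) unfolding modular_def by (rule ennreal_add_leD)
    finally have h_le: "(\<integral>\<^sup>+x. ennreal (h x) \<partial>lebesgue) \<le> 1" .
    then have h_int: "integrable lebesgue h"
      by (intro integrableI_nonneg) (auto simp: h_nn intro: order_le_less_trans)
    have "integral\<^sup>L lebesgue h \<le> 1"
      using h_le h_int by (simp add: nn_integral_eq_integral h_nn)
    have "esssup (lebesgue_on {x. t x = \<infinity>}) (\<lambda>x. indicator ?B x / ennreal l) \<le> 1"
      using l(2) unfolding modular_def by (rule ennreal_add_leD)
    then have "AE x in lebesgue_on {x. t x = \<infinity>}. indicator ?B x / ennreal l \<le> 1"
      by (intro eventually_mono[OF esssup_AE]) (rule order_trans)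
    then have "AE x in lebesgue. t x = \<infinity> \<longrightarrow> indicator ?B x / ennreal l \<le> 1"
      using measurable_sets[OF t_m, of "{\<infinity>}"] by (subst (asm) AE_restrict_space_iff) (auto simp: vimage_def)
    then have l_ge: "AE x in lebesgue. t x = \<infinity> \<longrightarrow> x \<in> ?B \<longrightarrow> 1 \<le> l"
    proof eventually_elim
      case (elim x)
      then show ?case
        using l(1) divide_ennreal[of 1 l] ennreal_le_iff[of 1 "1 / l"] by (auto simp: field_simps)
    qed
    have int1: "integrable lebesgue (\<lambda>x. indicator ?B x *\<^sub>R u x)"
      using integrable_on_ball[of u c R] u u_m by (simp add: set_integrable_def)
    have int2: "integrable lebesgue (indicator ?B :: 'a \<Rightarrow> real)"
      by (rule integrable_indicator_ball)
    have "(\<integral>x. ln V * (indicator ?B x *\<^sub>R u x) - ln l * indicator ?B x \<partial>lebesgue) \<le> (\<integral>x. V * h x \<partial>lebesgue)"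
    proof (rule integral_mono_AE)
      show "AE x in lebesgue. ln V * (indicator ?B x *\<^sub>R u x) - ln l * indicator ?B x \<le> V * h x"
        using l_ge
      proof eventually_elim
        case (elim x)
        consider "x \<notin> ?B" | "x \<in> ?B" "t x = \<infinity>" | "x \<in> ?B" "t x < \<infinity>"
          by (cases "t x = \<infinity>") (auto simp: less_top)
        then show ?case
        proof cases
          case 1
          then show ?thesis by (simp add: h_def)
        next
          case 2
          then have "u x = 0" "0 \<le> ln l" using elim by (auto simp: u_def recip_def)
          moreover have "0 \<le> V * h x" using V h_nn[of x] by simp
          ultimately show ?thesis using 2 by simp
        next
          case 3
          obtain a where a: "t x = ennreal a" "0 \<le> a"
            using 3 by (cases "t x") auto
          have "1 \<le> ennreal a" using t a by (metis (mono_tags, lifting) mem_Collect_eq var_exponents_def)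
          then have "1 \<le> a" using a(2) by simp
          then have ua: "u x = 1 / a" using a by (simp add: u_def recip_def inverse_ennreal inverse_eq_divide)
          define z where "z = V * (1 / l) powr a"
          have z: "0 < z" using V l by (simp add: z_def)
          \<comment> \<open>Since \<open>a \<ge> 1\<close>, dividing by \<open>a\<close> preserves the bound \<open>ln z \<le> z\<close>, also when \<open>ln z < 0\<close>.\<close>
          have "ln V * u x - ln l = ln z / a"
            using V l \<open>1 \<le> a\<close> by (simp add: z_def ua ln_mult ln_powr ln_div field_simps)
          also have "ln z / a \<le> z"
          proof (cases "0 \<le> ln z")
            case True
            then have "ln z / a \<le> ln z" using \<open>1 \<le> a\<close> divide_left_mono[of 1 a "ln z"] by simp
            also have "ln z \<le> z" using ln_bound[OF z] by simp
            finally show ?thesis .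
          next
            case False
            then have "ln z / a \<le> 0" using \<open>1 \<le> a\<close> by (simp add: divide_nonpos_nonneg)
            then show ?thesis using z by simp
          qed
          also have "z = V * h x" using 3 a by (simp add: z_def h_def)
          finally show ?thesis using 3 by simp
        qed
      qed
    qed (use int1 int2 h_int in auto)
    also have "(\<integral>x. ln V * (indicator ?B x *\<^sub>R u x) - ln l * indicator ?B x \<partial>lebesgue)
        = ln V * (average u ?B * V) - ln l * V"
      using int1 int2 V
      by (simp add: average_def set_lebesgue_integral_def V_def)
    also have "(\<integral>x. V * h x \<partial>lebesgue) \<le> V * 1"
      using V \<open>integral\<^sup>L lebesgue h \<le> 1\<close> by simp
    finally have "V * (average u ?B * ln V) \<le> V * (1 + ln l)"
      by (simp add: algebra_simps)
    then have "average u ?B * ln V \<le> 1 + ln l"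
      using V by simp
    then have "exp (average u ?B * ln V) \<le> exp (1 + ln l)" by simp
    moreover have "harmonic_volume t ?B = exp (average u ?B * ln V)"
      using V unfolding harmonic_volume_def V_def[symmetric] u_def[abs_def] powr_def by simp
    ultimately show ?thesis
      using l(1) by (simp add: exp_add)
  qed
  have "ennreal (harmonic_volume t ?B) / ennreal (exp 1) \<le> Lp_norm t (indicator ?B)"
    unfolding Lp_norm_def
  proof (rule INF_greatest)
    fix l assume l: "l \<in> {l. 0 < l \<and> modular t (\<lambda>x. indicator ?B x / ennreal l) \<le> 1}"
    then have "harmonic_volume t ?B / exp 1 \<le> l"
      using main[of l] by (simp add: field_simps)
    then show "ennreal (harmonic_volume t ?B) / ennreal (exp 1) \<le> ennreal l"
      using harmonic_volume_pos[OF R, of t c] by (subst divide_ennreal) (auto intro!: ennreal_leI)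
  qed
  then have "ennreal (exp 1) * (ennreal (harmonic_volume t ?B) / ennreal (exp 1)) \<le> ennreal (exp 1) * Lp_norm t (indicator ?B)"
    by (intro mult_left_mono) auto
  then show ?thesis
    using harmonic_volume_pos[OF R, of t c]
    by (subst (asm) divide_ennreal) (auto simp: ennreal_mult[symmetric])
qed

text \<open>Both factors are dominated by norms of indicators, the norm on the smaller ball grows when the ball
  is enlarged, and on the larger ball the Muckenhoupt constant bounds the product of the two norms.\<close>

lemma harmonic_volume_cross:
  fixes t :: "'a::euclidean_space \<Rightarrow> ennreal"
  assumes t: "t \<in> var_exponents" and A: "A_const t \<le> ennreal A" and "0 \<le> A"
    and R: "0 < R" "0 < R'" and sub: "ball c R \<subseteq> ball c' R'"
  shows "harmonic_volume t (ball c R) * harmonic_volume (conj_exponent t) (ball c' R') \<le> exp 2 * A * vol (ball c' R')"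
    and "harmonic_volume (conj_exponent t) (ball c R) * harmonic_volume t (ball c' R') \<le> exp 2 * A * vol (ball c' R')"
proof -
  let ?B = "ball c R" and ?B' = "ball c' R'" and ?t' = "conj_exponent t"
  note t' = conj_exponent_in_var_exponents[OF t]
  have "Lp_norm t (indicator ?B') * Lp_norm ?t' (indicator ?B') / emeasure lebesgue ?B' \<le> A_const t"
    unfolding A_const_def using R by (intro SUP_upper) (auto simp: balls_def)
  also note A
  finally have "Lp_norm t (indicator ?B') * Lp_norm ?t' (indicator ?B') / ennreal (vol ?B') * ennreal (vol ?B')
      \<le> ennreal A * ennreal (vol ?B')"
    unfolding emeasure_ball_eq_vol by (rule mult_right_mono) simp
  moreover have "Lp_norm t (indicator ?B') * Lp_norm ?t' (indicator ?B') / ennreal (vol ?B') * ennreal (vol ?B')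
      = Lp_norm t (indicator ?B') * Lp_norm ?t' (indicator ?B')"
    using vol_ball_pos[OF R(2), of c'] by (subst ennreal_divide_times) simp
  ultimately have N: "Lp_norm t (indicator ?B') * Lp_norm ?t' (indicator ?B') \<le> ennreal (A * vol ?B')"
    using \<open>0 \<le> A\<close> by (simp add: ennreal_mult)
  have le: "harmonic_volume a ?B * harmonic_volume b ?B' \<le> exp 2 * A * vol ?B'"
    if ab: "a \<in> var_exponents" "b \<in> var_exponents"
      "Lp_norm a (indicator ?B') * Lp_norm b (indicator ?B') \<le> ennreal (A * vol ?B')" for a b
  proof -
    have "Lp_norm a (indicator ?B) \<le> Lp_norm a (indicator ?B')"
      using sub by (intro Lp_norm_mono) (auto simp: indicator_def)
    then have "ennreal (exp 1) * Lp_norm a (indicator ?B) \<le> ennreal (exp 1) * Lp_norm a (indicator ?B')"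
      by (rule mult_left_mono) simp
    then have le_a: "ennreal (harmonic_volume a ?B) \<le> ennreal (exp 1) * Lp_norm a (indicator ?B')"
      by (rule order_trans[OF harmonic_volume_le_Lp_norm[OF ab(1) R(1)]])
    have "ennreal (harmonic_volume a ?B * harmonic_volume b ?B')
        = ennreal (harmonic_volume a ?B) * ennreal (harmonic_volume b ?B')"
      using harmonic_volume_pos[OF R(1), of a c] by (intro ennreal_mult) (auto simp: harmonic_volume_def)
    also have "\<dots> \<le> (ennreal (exp 1) * Lp_norm a (indicator ?B')) * (ennreal (exp 1) * Lp_norm b (indicator ?B'))"
      using le_a harmonic_volume_le_Lp_norm[OF ab(2) R(2)] by (intro mult_mono) auto
    also have "\<dots> = ennreal (exp 1) * ennreal (exp 1) * (Lp_norm a (indicator ?B') * Lp_norm b (indicator ?B'))"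
      by (simp only: ac_simps)
    also have "\<dots> \<le> ennreal (exp 1) * ennreal (exp 1) * ennreal (A * vol ?B')"
      by (intro mult_left_mono ab) auto
    also have "\<dots> = ennreal (exp 2 * A * vol ?B')"
      using \<open>0 \<le> A\<close> by (simp add: ennreal_mult[symmetric] exp_add[symmetric] mult.assoc)
    finally show ?thesis
      using \<open>0 \<le> A\<close> by (subst (asm) ennreal_le_iff) auto
  qed
  show "harmonic_volume t ?B * harmonic_volume ?t' ?B' \<le> exp 2 * A * vol ?B'"
    by (rule le[OF t t' N])
  show "harmonic_volume ?t' ?B * harmonic_volume t ?B' \<le> exp 2 * A * vol ?B'"
    using N by (intro le[OF t' t]) (simp add: mult.commute)
qed

text \<open>On a single ball the harmonic volumes of \<open>t\<close> and \<open>t'\<close> multiply to the volume.  Cancelling the factor on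
  the larger ball in the first cross estimate, and the factor on the smaller ball in the second one,
  leaves a comparison for one exponent.  The two exponents enter symmetrically.\<close>

lemma harmonic_volume_comparable:
  fixes t :: "'a::euclidean_space \<Rightarrow> ennreal"
  assumes t: "t \<in> var_exponents" and A: "A_const t < \<infinity>" and L: "1 \<le> L"
  obtains C where "0 < C"
    "\<And>(c :: 'a) R c' R'. 0 < R \<Longrightarrow> ball c R \<subseteq> ball c' R' \<Longrightarrow> R' \<le> L * R \<Longrightarrow>
      harmonic_volume t (ball c R) \<le> C * harmonic_volume t (ball c' R') \<and>
      harmonic_volume t (ball c' R') \<le> C * harmonic_volume t (ball c R) \<and>
      harmonic_volume (conj_exponent t) (ball c R) \<le> C * harmonic_volume (conj_exponent t) (ball c' R') \<and>
      harmonic_volume (conj_exponent t) (ball c' R') \<le> C * harmonic_volume (conj_exponent t) (ball c R)"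
proof -
  let ?t' = "conj_exponent t"
  note t' = conj_exponent_in_var_exponents[OF t]
  obtain A' where A': "A_const t \<le> ennreal A'" "1 \<le> A'"
  proof (rule that)
    show "A_const t \<le> ennreal (max 1 (enn2real (A_const t)))"
      using A by (metis ennreal_enn2real ennreal_leI infinity_ennreal_def max.cobounded2)
  qed simp
  define n where "n = DIM('a)"
  define K where "K = exp 2 * A'"
  define C where "C = K * L ^ n"
  have K: "0 < K" using A' by (simp add: K_def)
  have Ln: "1 \<le> L ^ n" using L by simp
  have KC: "K \<le> C" unfolding C_def using K Ln by simp
  show ?thesis
  proof (rule that)
    show "0 < C" using KC K by simp
    fix c c' :: 'a and R R' assume R: "0 < R" and sub: "ball c R \<subseteq> ball c' R'" and le: "R' \<le> L * R"
    have "ball c R \<noteq> {}" using R by simp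
    then have R': "0 < R'" using sub by (metis ball_eq_empty not_le subset_empty)
    have "R' ^ n \<le> (L * R) ^ n" using R' le by (intro power_mono) auto
    then have "unit_ball_vol (real n) * R' ^ n \<le> unit_ball_vol (real n) * (L ^ n * R ^ n)"
      by (intro mult_left_mono) (auto simp: power_mult_distrib)
    then have vol: "vol (ball c' R') \<le> L ^ n * vol (ball c R)"
      unfolding vol_ball[OF R] vol_ball[OF R'] n_def[symmetric] by (simp only: ac_simps)
    have cmp: "harmonic_volume a (ball c R) \<le> C * harmonic_volume a (ball c' R') \<and>
      harmonic_volume a (ball c' R') \<le> C * harmonic_volume a (ball c R)"
      if cross: "harmonic_volume a (ball c R) * harmonic_volume b (ball c' R') \<le> K * vol (ball c' R')"
        "harmonic_volume b (ball c R) * harmonic_volume a (ball c' R') \<le> K * vol (ball c' R')"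
      and prods: "harmonic_volume a (ball c R) * harmonic_volume b (ball c R) = vol (ball c R)"
        "harmonic_volume a (ball c' R') * harmonic_volume b (ball c' R') = vol (ball c' R')"
      for a b
    proof
      note pos = harmonic_volume_pos[OF R, of _ c] harmonic_volume_pos[OF R', of _ c']
      have "harmonic_volume a (ball c R) * harmonic_volume b (ball c' R')
          \<le> (K * harmonic_volume a (ball c' R')) * harmonic_volume b (ball c' R')"
        using cross(1) unfolding prods(2)[symmetric] by (simp add: ac_simps)
      then have "harmonic_volume a (ball c R) \<le> K * harmonic_volume a (ball c' R')"
        using pos by (simp only: mult_le_cancel_right_pos)
      also have "\<dots> \<le> C * harmonic_volume a (ball c' R')"
        using KC pos by (intro mult_right_mono less_imp_le[OF pos(2)]) 
      finally show "harmonic_volume a (ball c R) \<le> C * harmonic_volume a (ball c' R')" .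
      have "harmonic_volume a (ball c' R') * harmonic_volume b (ball c R) \<le> K * vol (ball c' R')"
        using cross(2) by (simp add: mult.commute)
      also have "\<dots> \<le> K * (L ^ n * vol (ball c R))"
        using K vol by (intro mult_left_mono) auto
      also have "\<dots> = (C * harmonic_volume a (ball c R)) * harmonic_volume b (ball c R)"
        unfolding prods(1)[symmetric] C_def by (simp add: ac_simps)
      finally show "harmonic_volume a (ball c' R') \<le> C * harmonic_volume a (ball c R)"
        using pos by (simp only: mult_le_cancel_right_pos)
    qed
    note cross = harmonic_volume_cross[OF t A'(1) _ R R' sub, folded K_def]
    note prods = harmonic_volume_conj(2)[OF t]
    show "harmonic_volume t (ball c R) \<le> C * harmonic_volume t (ball c' R') \<and>
      harmonic_volume t (ball c' R') \<le> C * harmonic_volume t (ball c R) \<and>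
      harmonic_volume ?t' (ball c R) \<le> C * harmonic_volume ?t' (ball c' R') \<and>
      harmonic_volume ?t' (ball c' R') \<le> C * harmonic_volume ?t' (ball c R)"
      using cmp[of t ?t'] cmp[of ?t' t] cross A'(2) prods[OF R, of c] prods[OF R', of c'] by (simp add: mult.commute)
  qed
qed

section \<open>Bounded operators\<close>

lemma bounded_opE:
  assumes "bounded_op Z Y T"
  obtains C where "0 \<le> C"
    "\<And>f. f \<in> borel_measurable lebesgue \<Longrightarrow> Z (modulus f) < \<infinity> \<Longrightarrow> Y (T f) \<le> ennreal C * Z (modulus f)"
proof -
  obtain C where C: "\<And>f. f \<in> borel_measurable lebesgue \<Longrightarrow> Z (modulus f) < \<infinity> \<Longrightarrow> Y (T f) \<le> ennreal C * Z (modulus f)"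
    using assms by (auto simp: bounded_op_def)
  have "ennreal C * Z (modulus f) \<le> ennreal (max 0 C) * Z (modulus f)" for f
    by (intro mult_right_mono ennreal_leI) auto
  with C show thesis
    by (intro that[of "max 0 C"]) (auto intro: order_trans)
qed

text \<open>Working with real upper bounds \<open>F > 0\<close> of the norm, instead of with the norm itself, avoids a separate
  treatment of functions whose norm is \<open>0\<close>.\<close>

lemma bounded_op_if_le_scaled:
  assumes K: "0 \<le> K"
    and le: "\<And>f F. f \<in> borel_measurable lebesgue \<Longrightarrow> 0 < F \<Longrightarrow> Z (modulus f) \<le> ennreal F \<Longrightarrow> Y (T f) \<le> ennreal (K * F)"
  shows "bounded_op Z Y T"
  unfolding bounded_op_def
proof (intro exI[of _ K] ballI impI)
  fix f :: "'a \<Rightarrow> complex" assume f: "f \<in> borel_measurable lebesgue" and "Z (modulus f) < \<infinity>"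
  then obtain z where z: "Z (modulus f) = ennreal z" "0 \<le> z"
    by (cases "Z (modulus f)") auto
  show "Y (T f) \<le> ennreal K * Z (modulus f)"
  proof (rule ennreal_le_epsilon)
    fix e :: real assume e: "0 < e"
    define F where "F = z + e / (K + 1)"
    have F: "0 < F" "z \<le> F" using e K z(2) by (auto simp: F_def intro: add_nonneg_pos)
    then have "Y (T f) \<le> ennreal (K * F)"
      by (intro le f) (auto simp: z intro: ennreal_leI)
    also have "K * F \<le> K * z + e"
      using K e by (simp add: F_def field_simps)
    also have "ennreal (K * z + e) = ennreal K * Z (modulus f) + ennreal e"
      using K e z by (simp add: ennreal_mult)
    finally show "Y (T f) \<le> ennreal K * Z (modulus f) + ennreal e"
      by (simp add: ennreal_leI)
  qed
qed

section \<open>Morrey norms and duality\<close>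

lemma morrey_norm_mono:
  assumes [measurable]: "f \<in> borel_measurable lebesgue" and "\<And>x. f x \<le> g x"
  shows "morrey_norm r p f \<le> morrey_norm r p g"
  unfolding morrey_norm_def
proof (intro SUP_mono bexI)
  fix B :: "'a set" assume "B \<in> balls"
  then have [measurable]: "B \<in> sets lebesgue" by (auto simp: balls_def)
  show "ennreal (vol B powr (recip (harmonic_mean r B) - recip (harmonic_mean p B))) * Lp_norm p (\<lambda>x. indicator B x * f x)
    \<le> ennreal (vol B powr (recip (harmonic_mean r B) - recip (harmonic_mean p B))) * Lp_norm p (\<lambda>x. indicator B x * g x)"
    using assms(2) by (intro mult_left_mono Lp_norm_mono) auto
qed

lemma morrey_norm_cmult:
  "0 < c \<Longrightarrow> morrey_norm r p (\<lambda>x. ennreal c * f x) = ennreal c * morrey_norm r p f"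
  unfolding morrey_norm_def SUP_mult_left_ennreal
  by (simp add: Lp_norm_cmult mult.left_commute[of _ "ennreal c"])

lemma morrey_norm_ball_le:
  "0 < R \<Longrightarrow> ennreal (vol (ball c R) powr (recip (harmonic_mean r (ball c R)) - recip (harmonic_mean p (ball c R))))
     * Lp_norm p (\<lambda>x. indicator (ball c R) x * f x) \<le> morrey_norm r p f"
  unfolding morrey_norm_def by (rule SUP_upper) (auto simp: balls_def)

lemma morrey_norm_indicator_pos:
  assumes "p \<in> var_exponents" "0 < R"
  shows "0 < morrey_norm r p (indicator (ball c R))"
proof -
  have "0 < ennreal (harmonic_volume p (ball c R))"
    using harmonic_volume_pos[OF assms(2)] by simp
  also have "\<dots> \<le> ennreal (exp 1) * Lp_norm p (indicator (ball c R))"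
    by (rule harmonic_volume_le_Lp_norm[OF assms])
  finally have *: "0 < Lp_norm p (indicator (ball c R))"
    by (auto simp: zero_less_iff_neq_zero)
  have eq: "(\<lambda>x. indicator (ball c R) x * indicator (ball c R) x :: ennreal) = indicator (ball c R)"
    by (auto simp: indicator_def)
  have "0 < ennreal (vol (ball c R) powr (recip (harmonic_mean r (ball c R)) - recip (harmonic_mean p (ball c R))))
     * Lp_norm p (indicator (ball c R))"
    using * vol_ball_pos[OF assms(2), of c] by (auto simp: ennreal_zero_less_mult_iff)
  also have "\<dots> \<le> morrey_norm r p (indicator (ball c R))"
    using morrey_norm_ball_le[OF assms(2), of c r p "indicator (ball c R)"] unfolding eq .
  finally show ?thesis .
qed

text \<open>Hoelder's inequality for a Morrey space and its associate space.\<close>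

lemma nn_integral_le_associate_norm:
  assumes [measurable]: "f \<in> borel_measurable lebesgue" "g \<in> borel_measurable lebesgue"
    and F: "0 < F" and le: "morrey_norm r p f \<le> ennreal F"
  shows "(\<integral>\<^sup>+x. f x * g x \<partial>lebesgue) \<le> ennreal F * associate_norm (morrey_norm r p) g"
proof -
  have "morrey_norm r p (\<lambda>x. ennreal (1 / F) * f x) \<le> ennreal (1 / F) * ennreal F"
    using F le by (subst morrey_norm_cmult) (auto intro: mult_left_mono)
  also have "\<dots> = 1" using F by (simp add: ennreal_mult[symmetric])
  finally have "(\<integral>\<^sup>+x. (ennreal (1 / F) * f x) * g x \<partial>lebesgue) \<le> associate_norm (morrey_norm r p) g"
    unfolding associate_norm_def by (intro SUP_upper) auto
  then have "ennreal F * (\<integral>\<^sup>+x. (ennreal (1 / F) * f x) * g x \<partial>lebesgue) \<le> ennreal F * associate_norm (morrey_norm r p) g"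
    by (rule mult_left_mono) simp
  also have "ennreal F * (\<integral>\<^sup>+x. (ennreal (1 / F) * f x) * g x \<partial>lebesgue) = (\<integral>\<^sup>+x. f x * g x \<partial>lebesgue)"
    using F by (simp add: mult.assoc nn_integral_cmult ennreal_mult_inverse_cancel)
  finally show ?thesis .
qed

section \<open>Necessity of testing conditions\<close>

lemma SUP_min_of_nat: "(SUP n. min x (of_nat n)) = (x :: ennreal)"
proof (rule antisym)
  show "x \<le> (SUP n. min x (of_nat n))"
  proof (cases x)
    case (real a)
    obtain n :: nat where "a \<le> real n" using real_arch_simple by blast
    then have "x \<le> min x (of_nat n)"
      using real by (simp add: ennreal_of_nat_eq_real_of_nat ennreal_leI)
    then show ?thesis by (rule SUP_upper2[rotated]) simp
  next
    case top
    moreover have "min top (of_nat n) = (of_nat n :: ennreal)" for n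
      by (rule min_absorb2) simp
    ultimately show ?thesis by (simp only: ennreal_SUP_of_nat_eq_top order_refl)
  qed
qed (simp add: SUP_least)

text \<open>If \<open>T f\<close> dominates the pairing of \<open>f\<close> with \<open>G i\<close> at all points of \<open>B i\<close>, then the norm of \<open>T f\<close> dominates
  that pairing times the norm of the indicator of \<open>B i\<close>; taking the supremum over the unit ball yields the
  associate norm.  The pairing can be infinite and the functions in the unit ball take values in
  \<open>[0, \<infinity>]\<close>, hence both are truncated and recovered by monotone convergence.  Both testing conditions are
  instances.\<close>

lemma testing_condition_if_bounded:
  fixes T :: "('a::euclidean_space \<Rightarrow> complex) \<Rightarrow> 'a \<Rightarrow> ennreal" and B :: "'i \<Rightarrow> 'a set"
  assumes bdd: "bounded_op (morrey_norm r p) (morrey_norm s q) T" and C: "0 < C"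
    and meas: "\<And>i. i \<in> I \<Longrightarrow> B i \<in> sets lebesgue" "\<And>i. i \<in> I \<Longrightarrow> G i \<in> borel_measurable lebesgue"
    and lower: "\<And>i f x. i \<in> I \<Longrightarrow> f \<in> borel_measurable lebesgue \<Longrightarrow> (\<And>y. 0 \<le> f y) \<Longrightarrow> x \<in> B i \<Longrightarrow>
      (\<integral>\<^sup>+y. ennreal (f y) * G i y \<partial>lebesgue) \<le> ennreal C * T (\<lambda>y. complex_of_real (f y)) x"
  shows "(SUP i\<in>I. morrey_norm s q (indicator (B i)) * associate_norm (morrey_norm r p) (G i)) < \<infinity>"
proof -
  obtain K where K: "0 \<le> K"
    "\<And>f. f \<in> borel_measurable lebesgue \<Longrightarrow> morrey_norm r p (modulus f) < \<infinity> \<Longrightarrow>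
      morrey_norm s q (T f) \<le> ennreal K * morrey_norm r p (modulus f)"
    using bdd by (rule bounded_opE) blast
  have "morrey_norm s q (indicator (B i)) * associate_norm (morrey_norm r p) (G i) \<le> ennreal (C * K)" if i: "i \<in> I" for i
    unfolding associate_norm_def SUP_mult_left_ennreal
  proof (rule SUP_least, safe)
    fix f assume f [measurable]: "f \<in> borel_measurable lebesgue" and f1: "morrey_norm r p f \<le> 1"
    have [measurable]: "B i \<in> sets lebesgue" "G i \<in> borel_measurable lebesgue"
      using meas i by auto
    let ?N = "morrey_norm s q (indicator (B i))"
    \<comment> \<open>A finite valued function is needed because the operator acts on complex valued functions.\<close>
    define fr where "fr n y = enn2real (min (f y) (of_nat n))" for n y
    have fr_m [measurable]: "fr n \<in> borel_measurable lebesgue" for n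
      unfolding fr_def[abs_def] by measurable
    have fr_eq: "ennreal (fr n y) = min (f y) (of_nat n)" for n y
      unfolding fr_def by (rule ennreal_enn2real) (simp add: min_less_iff_disj of_nat_less_top)
    define J where "J n = (\<integral>\<^sup>+y. ennreal (fr n y) * G i y \<partial>lebesgue)" for n
    \<comment> \<open>The pairing itself may be infinite, while homogeneity of the norm concerns real factors.\<close>
    have J_le: "?N * min (J n) (of_nat m) \<le> ennreal (C * K)" for n m
    proof -
      define d where "d = enn2real (min (J n) (of_nat m))"
      have d: "ennreal d = min (J n) (of_nat m)"
        unfolding d_def by (rule ennreal_enn2real) (simp add: min_less_iff_disj of_nat_less_top)
      show ?thesis
      proof (cases "d = 0")
        case False
        then have d0: "0 < d" by (simp add: d_def order_less_le)
        have Tx: "ennreal (d / C) * indicator (B i) x \<le> T (\<lambda>y. complex_of_real (fr n y)) x" for x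
        proof (cases "x \<in> B i")
          case True
          have "ennreal d \<le> J n" by (simp add: d)
          also have "J n \<le> ennreal C * T (\<lambda>y. complex_of_real (fr n y)) x"
            unfolding J_def using True by (intro lower i fr_m) (auto simp: fr_def)
          finally have "ennreal (1 / C) * ennreal d \<le> ennreal (1 / C) * (ennreal C * T (\<lambda>y. complex_of_real (fr n y)) x)"
            by (rule mult_left_mono) simp
          then have "ennreal (1 / C) * ennreal d \<le> T (\<lambda>y. complex_of_real (fr n y)) x"
            using C by (simp add: ennreal_mult_inverse_cancel)
          then show ?thesis using True C d0 by (simp add: ennreal_mult[symmetric])
        qed simp
        have nrm: "morrey_norm r p (modulus (\<lambda>y. complex_of_real (fr n y))) \<le> 1"
        proof -
          have "morrey_norm r p (modulus (\<lambda>y. complex_of_real (fr n y))) \<le> morrey_norm r p f"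
          proof (rule morrey_norm_mono)
            show "modulus (\<lambda>y. complex_of_real (fr n y)) y \<le> f y" for y
              using fr_eq[of n y] by (simp add: fr_def)
          qed simp
          then show ?thesis using f1 by (rule order_trans)
        qed
        have "ennreal (d / C) * ?N = morrey_norm s q (\<lambda>x. ennreal (d / C) * indicator (B i) x)"
          using d0 C by (simp add: morrey_norm_cmult)
        also have "\<dots> \<le> morrey_norm s q (T (\<lambda>y. complex_of_real (fr n y)))"
          by (rule morrey_norm_mono[OF _ Tx]) simp
        also have "\<dots> \<le> ennreal K * morrey_norm r p (modulus (\<lambda>y. complex_of_real (fr n y)))"
          by (rule K(2)[OF _ order_le_less_trans[OF nrm]]) auto
        also have "\<dots> \<le> ennreal K * 1"
          by (intro mult_left_mono nrm) simp
        finally have "ennreal C * (ennreal (d / C) * ?N) \<le> ennreal C * ennreal K"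
          by (intro mult_left_mono) auto
        moreover have "ennreal C * ennreal (d / C) = ennreal d"
          using C d0 by (simp add: ennreal_mult[symmetric])
        ultimately show ?thesis
          using C K(1) by (simp add: mult.assoc[symmetric] ennreal_mult d mult.commute)
      qed (use d in auto)
    qed
    have "?N * J n \<le> ennreal (C * K)" for n
      by (subst SUP_min_of_nat[of "J n", symmetric], unfold SUP_mult_left_ennreal) (intro SUP_least J_le)
    then have "?N * (SUP n. J n) \<le> ennreal (C * K)"
      unfolding SUP_mult_left_ennreal by (intro SUP_least)
    moreover have "(SUP n. J n) = (\<integral>\<^sup>+y. (SUP n. ennreal (fr n y) * G i y) \<partial>lebesgue)"
      unfolding J_def
    proof (rule nn_integral_monotone_convergence_SUP[symmetric])
      show "incseq (\<lambda>n y. ennreal (fr n y) * G i y)"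
        unfolding fr_eq
        by (intro monoI le_funI mult_right_mono min.mono) auto
    qed simp
    moreover have "(SUP n. ennreal (fr n y) * G i y) = f y * G i y" for y
      unfolding fr_eq SUP_mult_right_ennreal[symmetric] SUP_min_of_nat ..
    ultimately show "?N * (\<integral>\<^sup>+y. f y * G i y \<partial>lebesgue) \<le> ennreal (C * K)"
      by simp
  qed
  then have "(SUP i\<in>I. morrey_norm s q (indicator (B i)) * associate_norm (morrey_norm r p) (G i)) \<le> ennreal (C * K)"
    by (rule SUP_least)
  then show ?thesis
    by (rule order_le_less_trans) simp
qed

section \<open>Boundedness from a local estimate\<close>

lemma ennreal_le_divide_if_mult_le:
  assumes "N * a \<le> ennreal K" "0 < N"
  shows "a \<le> ennreal K / (N :: ennreal)"
proof (cases "N = top")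
  case True
  then have "a = 0" using assms(1) by (cases "a = 0") (auto simp: ennreal_top_mult top_unique)
  then show ?thesis by simp
next
  case False
  then have "a = N * a / N"
    using assms(2) by (simp add: mult.commute[of N] mult_divide_eq_ennreal)
  also have "\<dots> \<le> ennreal K / N"
    by (rule divide_right_mono_ennreal) (rule assms)
  finally show ?thesis .
qed

lemma ennreal_divide_mult_le: "ennreal a / N * N \<le> ennreal a"
  by (cases "N = 0 \<or> N = top") (auto simp: ennreal_divide_times less_top zero_less_iff_neq_zero)

text \<open>The common half of the sufficiency proofs.  On \<open>B = ball c R\<close> the function \<open>T f\<close> splits into the image
  of the part of \<open>f\<close> in \<open>2B\<close> and a constant.  The first is controlled by boundedness on the Lebesgue spaces,
  since the Morrey weights of \<open>B\<close> and \<open>2B\<close> are comparable and the weights of the two Morrey spaces agree;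
  the second is a multiple of the indicator of \<open>B\<close> whose Morrey norm is at most \<open>D F\<close>.\<close>

lemma morrey_bounded_if_local_estimate:
  fixes p q r s :: "'a::euclidean_space \<Rightarrow> ennreal" and T :: "('a \<Rightarrow> complex) \<Rightarrow> 'a \<Rightarrow> ennreal"
  assumes p: "p \<in> var_exponents" and q: "q \<in> var_exponents" and r: "r \<in> var_exponents" and s: "s \<in> var_exponents"
    and gap: "AE x in lebesgue. recip (p x) - recip (q x) = recip (r x) - recip (s x)"
    and A: "A_const p < \<infinity>" "A_const r < \<infinity>"
    and bdd: "bounded_op (Lp_norm p) (Lp_norm q) T"
    and T_m: "\<And>f. f \<in> borel_measurable lebesgue \<Longrightarrow> T f \<in> borel_measurable lebesgue"
    and D: "0 \<le> D"
    and near: "\<And>f F c R x. f \<in> borel_measurable lebesgue \<Longrightarrow> 0 < F \<Longrightarrow> morrey_norm r p (modulus f) \<le> ennreal F \<Longrightarrow>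
      0 < R \<Longrightarrow> x \<in> ball c R \<Longrightarrow>
      T f x \<le> T (\<lambda>y. indicator (ball c (2 * R)) y *\<^sub>R f y) x + ennreal (D * F) / morrey_norm s q (indicator (ball c R))"
  shows "bounded_op (morrey_norm r p) (morrey_norm s q) T"
proof -
  define w where "w a b B = vol B powr (recip (harmonic_mean a B) - recip (harmonic_mean b B))"
    for a b :: "'a \<Rightarrow> ennreal" and B :: "'a set"
  have w_eq: "w a b (ball c R) = harmonic_volume a (ball c R) / harmonic_volume b (ball c R)"
    if "a \<in> var_exponents" "b \<in> var_exponents" "0 < R" for a b c R
    using that by (simp add: w_def recip_harmonic_mean harmonic_volume_def powr_diff)
  have w_pos: "0 < w a b (ball c R)" if "0 < R" for a b c R
    using that by (simp add: w_def)
  have w_gap: "w s q (ball c R) = w r p (ball c R)" if R: "0 < R" for c R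
  proof -
    have m [measurable]: "p \<in> borel_measurable lebesgue" "q \<in> borel_measurable lebesgue"
      "r \<in> borel_measurable lebesgue" "s \<in> borel_measurable lebesgue"
      using p q r s by (auto simp: var_exponents_def)
    have avg: "average (\<lambda>x. recip (a x) - recip (b x)) (ball c R)
        = recip (harmonic_mean a (ball c R)) - recip (harmonic_mean b (ball c R))"
      if ab: "a \<in> var_exponents" "b \<in> var_exponents" for a b
    proof -
      have [measurable]: "a \<in> borel_measurable lebesgue" "b \<in> borel_measurable lebesgue"
        using ab by (auto simp: var_exponents_def)
      have "(LINT x:ball c R|lebesgue. recip (a x) - recip (b x))
          = (LINT x:ball c R|lebesgue. recip (a x)) - (LINT x:ball c R|lebesgue. recip (b x))"
        by (intro set_integral_diff(2) integrable_on_ball) (auto simp: inverse_exponent[OF ab(1)] inverse_exponent[OF ab(2)])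
      then show ?thesis
        unfolding recip_harmonic_mean[OF ab(1) R] recip_harmonic_mean[OF ab(2) R]
        by (simp add: average_def diff_divide_distrib)
    qed
    have "average (\<lambda>x. recip (p x) - recip (q x)) (ball c R) = average (\<lambda>x. recip (r x) - recip (s x)) (ball c R)"
      unfolding average_def set_lebesgue_integral_def
      by (intro arg_cong2[where f = "(/)"] integral_cong_AE) (use gap in \<open>auto elim: eventually_mono\<close>)
    then have "recip (harmonic_mean s (ball c R)) - recip (harmonic_mean q (ball c R))
        = recip (harmonic_mean r (ball c R)) - recip (harmonic_mean p (ball c R))"
      unfolding avg[OF p q] avg[OF r s] by linarith
    then show ?thesis
      by (simp only: w_def)
  qed
  obtain C1 where C1: "0 < C1" "\<And>(c :: 'a) R c' R'. 0 < R \<Longrightarrow> ball c R \<subseteq> ball c' R' \<Longrightarrow> R' \<le> 2 * R \<Longrightarrow>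
      harmonic_volume p (ball c' R') \<le> C1 * harmonic_volume p (ball c R)"
    using harmonic_volume_comparable[OF p A(1), of 2] by (metis one_le_numeral)
  obtain C2 where C2: "0 < C2" "\<And>(c :: 'a) R c' R'. 0 < R \<Longrightarrow> ball c R \<subseteq> ball c' R' \<Longrightarrow> R' \<le> 2 * R \<Longrightarrow>
      harmonic_volume r (ball c R) \<le> C2 * harmonic_volume r (ball c' R')"
    using harmonic_volume_comparable[OF r A(2), of 2] by (metis one_le_numeral)
  have w_double: "w r p (ball c R) \<le> C1 * C2 * w r p (ball c (2 * R))" if R: "0 < R" for c R
  proof -
    have sub: "ball c R \<subseteq> ball c (2 * R)" using R by (intro subset_ball) simp
    have pos: "0 < harmonic_volume a (ball c R)" "0 < harmonic_volume a (ball c (2 * R))" for a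
      using R harmonic_volume_pos[of R a c] harmonic_volume_pos[of "2 * R" a c] by auto
    have "harmonic_volume r (ball c R) * harmonic_volume p (ball c (2 * R))
        \<le> (C2 * harmonic_volume r (ball c (2 * R))) * (C1 * harmonic_volume p (ball c R))"
      using C1(2)[OF R sub] C2(2)[OF R sub] C2(1) less_imp_le[OF pos(2)] by (intro mult_mono) auto
    then show ?thesis
      using R pos by (simp add: w_eq p r field_simps)
  qed
  obtain C0 where C0: "0 \<le> C0"
    "\<And>f. f \<in> borel_measurable lebesgue \<Longrightarrow> Lp_norm p (modulus f) < \<infinity> \<Longrightarrow> Lp_norm q (T f) \<le> ennreal C0 * Lp_norm p (modulus f)"
    using bdd by (rule bounded_opE) blast
  define K where "K = 4 * (C1 * C2 * C0 + D)"
  show ?thesis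
  proof (rule bounded_op_if_le_scaled)
    show "0 \<le> K" using C0 C1 C2 D by (simp add: K_def)
    fix f :: "'a \<Rightarrow> complex" and F :: real
    assume f [measurable]: "f \<in> borel_measurable lebesgue" and F: "0 < F" and fF: "morrey_norm r p (modulus f) \<le> ennreal F"
    note [measurable] = T_m
    show "morrey_norm s q (T f) \<le> ennreal (K * F)"
      unfolding morrey_norm_def w_def[symmetric]
    proof (rule SUP_least)
      fix B :: "'a set" assume "B \<in> balls"
      then obtain c R where B: "B = ball c R" and R: "0 < R" by (auto simp: balls_def)
      let ?B = "ball c R" and ?B2 = "ball c (2 * R)"
      let ?N = "morrey_norm s q (indicator ?B)"
      define f2 where "f2 y = indicator ?B2 y *\<^sub>R f y" for y
      have f2 [measurable]: "f2 \<in> borel_measurable lebesgue"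
        unfolding f2_def[abs_def] by measurable
      have f2_mod: "modulus f2 = (\<lambda>x. indicator ?B2 x * modulus f x)"
        by (auto simp: f2_def indicator_def)
      have loc2: "ennreal (w r p ?B2) * Lp_norm p (modulus f2) \<le> ennreal F"
        unfolding f2_mod w_def using R by (intro order_trans[OF morrey_norm_ball_le fF]) simp
      then have fin: "Lp_norm p (modulus f2) < \<infinity>"
        using w_pos[of "2 * R" r p c] R by (cases "Lp_norm p (modulus f2)") (auto simp: ennreal_mult_top top_unique)
      have "0 < ?N" by (rule morrey_norm_indicator_pos[OF q R])
      \<comment> \<open>If the norm \<open>?N\<close> of the indicator is infinite, the quotient is \<open>0\<close>.\<close>
      then have "ennreal (D * F) / ?N < top"
        by (auto simp: less_top[symmetric] ennreal_divide_eq_top_iff)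
      then obtain a where a: "ennreal (D * F) / ?N = ennreal a" "0 \<le> a"
        by (cases "ennreal (D * F) / ?N") auto
      have "Lp_norm q (\<lambda>x. indicator ?B x * T f x) \<le> Lp_norm q (\<lambda>x. T f2 x + ennreal a * indicator ?B x)"
      proof (rule Lp_norm_mono)
        show "indicator ?B x * T f x \<le> T f2 x + ennreal a * indicator ?B x" for x
          using near[OF f F fF R, of x c] unfolding a f2_def[symmetric, abs_def] by (auto simp: indicator_def)
      qed measurable
      also have "\<dots> \<le> 4 * (Lp_norm q (T f2) + Lp_norm q (\<lambda>x. ennreal a * indicator ?B x))"
        by (intro Lp_norm_add q) measurable
      finally have "ennreal (w s q ?B) * Lp_norm q (\<lambda>x. indicator ?B x * T f x)
          \<le> ennreal (w s q ?B) * (4 * (Lp_norm q (T f2) + Lp_norm q (\<lambda>x. ennreal a * indicator ?B x)))"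
        by (rule mult_left_mono) simp
      also have "\<dots> = 4 * (ennreal (w s q ?B) * Lp_norm q (T f2) + ennreal (w s q ?B) * Lp_norm q (\<lambda>x. ennreal a * indicator ?B x))"
        by (simp add: distrib_left ac_simps)
      also have "\<dots> \<le> 4 * (ennreal (C1 * C2 * C0 * F) + ennreal (D * F))"
      proof (intro mult_left_mono add_mono)
        have "ennreal (w s q ?B) * Lp_norm q (T f2) \<le> ennreal (C1 * C2 * w r p ?B2) * (ennreal C0 * Lp_norm p (modulus f2))"
          using w_double[OF R, of c] by (intro mult_mono C0 f2 fin ennreal_leI) (auto simp: w_gap[OF R])
        also have "\<dots> = ennreal (C1 * C2 * C0) * (ennreal (w r p ?B2) * Lp_norm p (modulus f2))"
          using C1 C2 C0 w_pos[of "2 * R" r p c] R by (simp add: ennreal_mult ac_simps)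
        also have "\<dots> \<le> ennreal (C1 * C2 * C0) * ennreal F"
          by (rule mult_left_mono[OF loc2]) simp
        also have "\<dots> = ennreal (C1 * C2 * C0 * F)"
          using C1 C2 C0 F by (simp add: ennreal_mult)
        finally show "ennreal (w s q ?B) * Lp_norm q (T f2) \<le> ennreal (C1 * C2 * C0 * F)" .
        have ind: "(\<lambda>x. indicator ?B x * indicator ?B x :: ennreal) = indicator ?B"
          by (auto simp: indicator_def)
        have "ennreal (w s q ?B) * Lp_norm q (\<lambda>x. ennreal a * indicator ?B x)
            \<le> ennreal (w s q ?B) * (ennreal a * Lp_norm q (indicator ?B))"
          by (intro mult_left_mono Lp_norm_cmult_le a) simp
        also have "\<dots> = ennreal a * (ennreal (w s q ?B) * Lp_norm q (indicator ?B))"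
          by (simp only: ac_simps)
        also have "\<dots> \<le> ennreal a * ?N"
          using morrey_norm_ball_le[OF R, of c s q "indicator ?B"] unfolding ind w_def by (rule mult_left_mono) simp
        also have "\<dots> \<le> ennreal (D * F)"
          unfolding a(1)[symmetric] by (rule ennreal_divide_mult_le)
        finally show "ennreal (w s q ?B) * Lp_norm q (\<lambda>x. ennreal a * indicator ?B x) \<le> ennreal (D * F)" .
      qed simp
      also have "\<dots> = ennreal (K * F)"
      proof -
        have "ennreal (K * F) = ennreal 4 * (ennreal (C1 * C2 * C0 * F + D * F))"
          using C1 C2 C0 D F by (subst ennreal_mult[symmetric]) (auto simp: K_def algebra_simps)
        then show ?thesis using C1 C2 C0 D F by simp
      qed
      finally show "ennreal (w s q B) * Lp_norm q (\<lambda>x. indicator B x * T f x) \<le> ennreal (K * F)"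
        unfolding B .
    qed
  qed
qed

section \<open>Fractional volumes of balls\<close>

lemma alpha_as_exponent:
  fixes \<alpha> :: "'a::euclidean_space \<Rightarrow> real"
  assumes a: "\<forall>x. 0 \<le> \<alpha> x \<and> \<alpha> x \<le> 1" and v: "(\<lambda>x. inverse (ennreal (\<alpha> x))) \<in> var_exponents"
  shows "\<alpha> \<in> borel_measurable lebesgue" "recip (inverse (ennreal (\<alpha> x))) = \<alpha> x"
proof -
  have *: "recip (inverse (ennreal (\<alpha> x))) = \<alpha> x" for x
    using a by (simp add: recip_def ennreal_inverse_inverse)
  then show "recip (inverse (ennreal (\<alpha> x))) = \<alpha> x" .
  have "(\<lambda>x. recip (inverse (ennreal (\<alpha> x)))) \<in> borel_measurable lebesgue"
    using v by (intro recip_measurable) (simp add: var_exponents_def)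
  then show "\<alpha> \<in> borel_measurable lebesgue" by (simp add: *)
qed

text \<open>With \<open>t = 1/\<alpha>\<close>, the number \<open>|B|\<close> to the power \<open>1 - \<langle>\<alpha>\<rangle>\<^sub>B\<close> is the harmonic volume of \<open>B\<close> for the conjugate
  of \<open>t\<close>.\<close>

lemma fractional_volume_comparable:
  fixes \<alpha> :: "'a::euclidean_space \<Rightarrow> real"
  assumes a: "\<forall>x. 0 \<le> \<alpha> x \<and> \<alpha> x \<le> 1" and v: "(\<lambda>x. inverse (ennreal (\<alpha> x))) \<in> var_exponents"
    and A: "A_const (\<lambda>x. inverse (ennreal (\<alpha> x))) < \<infinity>" and L: "1 \<le> L"
  obtains C where "0 < C"
    "\<And>(c :: 'a) R c' R'. 0 < R \<Longrightarrow> ball c R \<subseteq> ball c' R' \<Longrightarrow> R' \<le> L * R \<Longrightarrow>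
      vol (ball c R) powr (1 - average \<alpha> (ball c R)) \<le> C * vol (ball c' R') powr (1 - average \<alpha> (ball c' R')) \<and>
      vol (ball c' R') powr (1 - average \<alpha> (ball c' R')) \<le> C * vol (ball c R) powr (1 - average \<alpha> (ball c R))"
proof -
  let ?t = "\<lambda>x. inverse (ennreal (\<alpha> x))"
  have eq: "harmonic_volume (conj_exponent ?t) (ball c R) = vol (ball c R) powr (1 - average \<alpha> (ball c R))"
    if "0 < R" for c :: 'a and R
    using harmonic_volume_conj(1)[OF v that] by (simp add: alpha_as_exponent(2)[OF a v])
  obtain C where C: "0 < C" "\<And>(c :: 'a) R c' R'. 0 < R \<Longrightarrow> ball c R \<subseteq> ball c' R' \<Longrightarrow> R' \<le> L * R \<Longrightarrow>
      harmonic_volume (conj_exponent ?t) (ball c R) \<le> C * harmonic_volume (conj_exponent ?t) (ball c' R') \<and>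
      harmonic_volume (conj_exponent ?t) (ball c' R') \<le> C * harmonic_volume (conj_exponent ?t) (ball c R)"
    using harmonic_volume_comparable[OF v A L] by metis
  show ?thesis
  proof (rule that[OF C(1)])
    fix c c' :: 'a and R R' assume R: "0 < R" and sub: "ball c R \<subseteq> ball c' R'" and le: "R' \<le> L * R"
    have "ball c R \<noteq> {}" using R by simp
    then have R': "0 < R'" using sub by (metis ball_eq_empty not_le subset_empty)
    show "vol (ball c R) powr (1 - average \<alpha> (ball c R)) \<le> C * vol (ball c' R') powr (1 - average \<alpha> (ball c' R')) \<and>
      vol (ball c' R') powr (1 - average \<alpha> (ball c' R')) \<le> C * vol (ball c R) powr (1 - average \<alpha> (ball c R))"
      using C(2)[OF R sub le] unfolding eq[OF R] eq[OF R'] .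
  qed
qed

section \<open>The fractional maximal operator\<close>

text \<open>The maximal function is lower semicontinuous, as a supremum of multiples of indicators of open balls.\<close>

lemma maximal_op_measurable: "maximal_op \<alpha> f \<in> borel_measurable (lebesgue :: 'a::euclidean_space measure)"
proof -
  define u where "u B = (\<integral>\<^sup>+y\<in>B. modulus f y \<partial>lebesgue) / ennreal (vol B powr (1 - average \<alpha> B))" for B
  have eq: "maximal_op \<alpha> f x = (SUP B\<in>balls. indicator B x * u B)" for x
    unfolding maximal_op_def u_def by (simp add: divide_ennreal_def ac_simps)
  have "maximal_op \<alpha> f \<in> borel_measurable borel"
  proof (rule borel_measurableI_greater)
    fix a
    have "{x. a < maximal_op \<alpha> f x} = (\<Union>B\<in>{B\<in>balls. a < u B}. B)"
    proof (intro set_eqI iffI)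
      fix x assume "x \<in> {x. a < maximal_op \<alpha> f x}"
      then obtain B where "B \<in> balls" "a < indicator B x * u B"
        by (auto simp: eq less_SUP_iff)
      then show "x \<in> (\<Union>B\<in>{B\<in>balls. a < u B}. B)"
        by (cases "x \<in> B") auto
    next
      fix x assume "x \<in> (\<Union>B\<in>{B\<in>balls. a < u B}. B)"
      then obtain B where "B \<in> balls" "a < indicator B x * u B" by auto
      then show "x \<in> {x. a < maximal_op \<alpha> f x}"
        by (auto simp: eq less_SUP_iff)
    qed
    also have "open \<dots>" by (auto simp: balls_def)
    finally have "{x. a < maximal_op \<alpha> f x} \<in> sets borel" by simp
    then show "{x \<in> space borel. a < maximal_op \<alpha> f x} \<in> sets borel" by simp
  qed
  then show ?thesis
    by (intro measurable_completion) simp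
qed

lemma maximal_op_ge:
  assumes "0 < R" "x \<in> ball c R"
  shows "(\<integral>\<^sup>+y\<in>ball c R. modulus f y \<partial>lebesgue) / ennreal (vol (ball c R) powr (1 - average \<alpha> (ball c R))) \<le> maximal_op \<alpha> f x"
proof -
  have "indicator (ball c R) x / ennreal (vol (ball c R) powr (1 - average \<alpha> (ball c R)))
                     * (\<integral>\<^sup>+y\<in>ball c R. modulus f y \<partial>lebesgue) \<le> maximal_op \<alpha> f x"
    unfolding maximal_op_def using assms by (intro SUP_upper) (auto simp: balls_def)
  then show ?thesis using assms by (simp add: divide_ennreal_def ac_simps)
qed

lemma associate_norm_divide:
  assumes [measurable]: "g \<in> borel_measurable lebesgue"
  shows "associate_norm Y (\<lambda>x. g x / k) = associate_norm Y g / k"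
  unfolding associate_norm_def SUP_divide_ennreal
proof (intro SUP_cong refl)
  fix f assume "f \<in> {f. f \<in> borel_measurable lebesgue \<and> Y f \<le> 1}"
  then have [measurable]: "f \<in> borel_measurable lebesgue" by simp
  show "(\<integral>\<^sup>+x. f x * (g x / k) \<partial>lebesgue) = (\<integral>\<^sup>+x. f x * g x \<partial>lebesgue) / k"
    by (simp add: ennreal_times_divide nn_integral_divide)
qed

text \<open>The average over \<open>B\<close> is one of those in the supremum at every point of \<open>B\<close>.\<close>

lemma maximal_testing_if_bounded:
  assumes bdd: "bounded_op (morrey_norm r p) (morrey_norm s q) (maximal_op \<alpha>)"
  shows "(SUP B\<in>balls. morrey_norm s q (indicator B) * associate_norm (morrey_norm r p) (indicator B)
       / ennreal (vol B powr (1 - average \<alpha> B))) < \<infinity>"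
proof -
  let ?G = "\<lambda>B y. indicator B y / ennreal (vol B powr (1 - average \<alpha> B))"
  have sets: "B \<in> sets lebesgue" if "B \<in> balls" for B :: "'a set"
    using that by (auto simp: balls_def)
  have "(SUP B\<in>balls. morrey_norm s q (indicator B) * associate_norm (morrey_norm r p) (?G B)) < \<infinity>"
  proof (rule testing_condition_if_bounded[OF bdd, of 1])
    fix B :: "'a set" and f :: "'a \<Rightarrow> real" and x
    assume B: "B \<in> balls" and f [measurable]: "f \<in> borel_measurable lebesgue" and f_nn: "\<And>y. 0 \<le> f y" and x: "x \<in> B"
    have [measurable]: "B \<in> sets lebesgue" using B by (rule sets)
    obtain c R where B_eq: "B = ball c R" "0 < R" using B by (auto simp: balls_def)
    have "(\<integral>\<^sup>+y. ennreal (f y) * ?G B y \<partial>lebesgue)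
        = (\<integral>\<^sup>+y\<in>B. modulus (\<lambda>y. complex_of_real (f y)) y \<partial>lebesgue) / ennreal (vol B powr (1 - average \<alpha> B))"
      using f_nn by (simp add: ennreal_times_divide nn_integral_divide)
    also have "\<dots> \<le> maximal_op \<alpha> (\<lambda>y. complex_of_real (f y)) x"
      using x unfolding B_eq(1) by (rule maximal_op_ge[OF B_eq(2)])
    finally show "(\<integral>\<^sup>+y. ennreal (f y) * ?G B y \<partial>lebesgue) \<le> ennreal 1 * maximal_op \<alpha> (\<lambda>y. complex_of_real (f y)) x"
      by simp
  qed (use sets in auto)
  then show ?thesis
    using sets by (simp add: associate_norm_divide ennreal_times_divide cong: SUP_cong_simp)
qed

text \<open>A ball containing \<open>x\<close> that lies in \<open>2B\<^sub>0\<close>, where \<open>B\<^sub>0 = ball c R\<close>, sees only the part of \<open>f\<close> inside \<open>2B\<^sub>0\<close>.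
  Any other one has radius more than \<open>R/2\<close>, so its fivefold dilate contains \<open>B\<^sub>0\<close>; duality and the testing
  condition on that dilate bound the average.\<close>

lemma maximal_local_estimate:
  fixes \<alpha> :: "'a::euclidean_space \<Rightarrow> real"
  assumes a: "\<forall>x. 0 \<le> \<alpha> x \<and> \<alpha> x \<le> 1" and v: "(\<lambda>x. inverse (ennreal (\<alpha> x))) \<in> var_exponents"
    and A: "A_const (\<lambda>x. inverse (ennreal (\<alpha> x))) < \<infinity>"
    and q: "q \<in> var_exponents"
    and test: "(SUP B\<in>balls. morrey_norm s q (indicator B) * associate_norm (morrey_norm r p) (indicator B)
       / ennreal (vol B powr (1 - average \<alpha> B))) < \<infinity>"
  obtains D where "0 \<le> D" "\<And>f F (c :: 'a) R x. f \<in> borel_measurable lebesgue \<Longrightarrow> 0 < F \<Longrightarrow> morrey_norm r p (modulus f) \<le> ennreal F \<Longrightarrow>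
      0 < R \<Longrightarrow> x \<in> ball c R \<Longrightarrow>
      maximal_op \<alpha> f x \<le> maximal_op \<alpha> (\<lambda>y. indicator (ball c (2 * R)) y *\<^sub>R f y) x
        + ennreal (D * F) / morrey_norm s q (indicator (ball c R))"
proof -
  define U where "U B = vol B powr (1 - average \<alpha> B)" for B
  have U_pos: "0 < U (ball c R)" if "0 < R" for c R
    using that by (simp add: U_def)
  obtain E where E: "0 < E" "\<And>(c :: 'a) R c' R'. 0 < R \<Longrightarrow> ball c R \<subseteq> ball c' R' \<Longrightarrow> R' \<le> 5 * R \<Longrightarrow>
      U (ball c' R') \<le> E * U (ball c R)"
    using fractional_volume_comparable[OF a v A, of 5] unfolding U_def by (metis one_le_numeral)
  define S where "S = (SUP B\<in>balls. morrey_norm s q (indicator B) * associate_norm (morrey_norm r p) (indicator B)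
       / ennreal (U B))"
  obtain K where K: "S = ennreal K" "0 \<le> K"
    using test unfolding U_def[symmetric] S_def[symmetric] by (cases S) auto
  show ?thesis
  proof (rule that[of "E * K"])
    show "0 \<le> E * K" using E K by simp
    fix f :: "'a \<Rightarrow> complex" and F R :: real and c x :: 'a
    assume f [measurable]: "f \<in> borel_measurable lebesgue" and F: "0 < F" and fF: "morrey_norm r p (modulus f) \<le> ennreal F"
      and R: "0 < R" and x: "x \<in> ball c R"
    let ?N = "morrey_norm s q (indicator (ball c R))"
    let ?f2 = "\<lambda>y. indicator (ball c (2 * R)) y *\<^sub>R f y"
    show "maximal_op \<alpha> f x \<le> maximal_op \<alpha> ?f2 x + ennreal (E * K * F) / ?N"
      unfolding maximal_op_def[of \<alpha> f x]
    proof (rule SUP_least)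
      fix B :: "'a set" assume "B \<in> balls"
      then obtain d \<rho> where B: "B = ball d \<rho>" and \<rho>: "0 < \<rho>" by (auto simp: balls_def)
      show "indicator B x / ennreal (vol B powr (1 - average \<alpha> B)) * (\<integral>\<^sup>+y\<in>B. modulus f y \<partial>lebesgue)
          \<le> maximal_op \<alpha> ?f2 x + ennreal (E * K * F) / ?N"
      proof (cases "x \<in> B")
        case xB: True
        have eq: "indicator B x / ennreal (vol B powr (1 - average \<alpha> B)) * (\<integral>\<^sup>+y\<in>B. modulus f y \<partial>lebesgue)
           = (\<integral>\<^sup>+y\<in>B. modulus f y \<partial>lebesgue) / ennreal (U B)"
          using xB by (simp add: U_def divide_ennreal_def ac_simps)
        show ?thesis
        proof (cases "B \<subseteq> ball c (2 * R)")
          case True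
          have "(\<integral>\<^sup>+y\<in>B. modulus f y \<partial>lebesgue) = (\<integral>\<^sup>+y\<in>B. modulus ?f2 y \<partial>lebesgue)"
            using True by (intro nn_integral_cong) (auto simp: indicator_def)
          then have "(\<integral>\<^sup>+y\<in>B. modulus f y \<partial>lebesgue) / ennreal (U B) \<le> maximal_op \<alpha> ?f2 x"
            using maximal_op_ge[OF \<rho>, of x d ?f2 \<alpha>] xB unfolding B U_def by simp
          then show ?thesis unfolding eq by (rule add_increasing2[rotated]) simp
        next
          case False
          then obtain z where z: "dist d z < \<rho>" "2 * R \<le> dist c z" unfolding B by (auto simp: subset_iff)
          have "dist c z \<le> dist c x + dist d x + dist d z"
            by (metis add_mono dist_commute dist_triangle order.refl order_trans)
          then have "R < 2 * \<rho>"
            using z x xB unfolding B by simp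
          have sub: "ball c R \<subseteq> ball d (5 * \<rho>)"
          proof
            fix y assume "y \<in> ball c R"
            then have "dist c y < R" by simp
            moreover have "dist d y \<le> dist d x + dist c x + dist c y"
              by (metis add_mono dist_commute dist_triangle order.refl order_trans)
            ultimately show "y \<in> ball d (5 * \<rho>)"
              using x xB \<open>R < 2 * \<rho>\<close> unfolding B by simp
          qed
          let ?B' = "ball d (5 * \<rho>)"
          have \<rho>': "0 < 5 * \<rho>" using \<rho> by simp
          let ?N' = "morrey_norm s q (indicator ?B')"
          have N: "0 < ?N" "?N \<le> ?N'"
            using sub by (auto intro!: morrey_norm_indicator_pos[OF q R] morrey_norm_mono simp: indicator_def)
          have "?N' * associate_norm (morrey_norm r p) (indicator ?B') / ennreal (U ?B') \<le> S"
            unfolding S_def using \<rho>' unfolding balls_def by (intro SUP_upper) blast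
          then have "?N' * (associate_norm (morrey_norm r p) (indicator ?B') / ennreal (U ?B')) \<le> ennreal K"
            by (simp add: ennreal_times_divide K)
          then have "?N * (associate_norm (morrey_norm r p) (indicator ?B') / ennreal (U ?B')) \<le> ennreal K"
            using mult_right_mono[OF N(2)] by (rule order_trans[rotated]) simp
          then have dual: "associate_norm (morrey_norm r p) (indicator ?B') / ennreal (U ?B') \<le> ennreal K / ?N"
            using N(1) by (rule ennreal_le_divide_if_mult_le)
          have Ui: "inverse (ennreal (U B)) \<le> ennreal E * inverse (ennreal (U ?B'))"
          proof -
            have pos: "0 < U B" "0 < U ?B'" using U_pos[OF \<rho>, of d] U_pos[OF \<rho>', of d] by (auto simp: B)
            have "U ?B' \<le> E * U B"
              unfolding B using \<rho> by (intro E subset_ball) auto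
            then have "inverse (U B) \<le> E * inverse (U ?B')"
              using pos E(1) by (simp add: field_simps)
            then show ?thesis
              using pos E(1) by (simp add: inverse_ennreal ennreal_mult[symmetric] ennreal_leI)
          qed
          have "(\<integral>\<^sup>+y\<in>B. modulus f y \<partial>lebesgue) \<le> (\<integral>\<^sup>+y\<in>?B'. modulus f y \<partial>lebesgue)"
            using \<rho> unfolding B by (intro nn_integral_mono) (auto simp: indicator_def)
          also have "\<dots> \<le> ennreal F * associate_norm (morrey_norm r p) (indicator ?B')"
            using F fF by (intro nn_integral_le_associate_norm) auto
          finally have "(\<integral>\<^sup>+y\<in>B. modulus f y \<partial>lebesgue) / ennreal (U B)
              \<le> (ennreal F * associate_norm (morrey_norm r p) (indicator ?B')) * (ennreal E * inverse (ennreal (U ?B')))"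
            unfolding divide_ennreal_def using Ui by (intro mult_mono) auto
          also have "\<dots> = ennreal (E * F) * (associate_norm (morrey_norm r p) (indicator ?B') / ennreal (U ?B'))"
            using E F by (simp add: divide_ennreal_def ennreal_mult ac_simps)
          also have "\<dots> \<le> ennreal (E * F) * (ennreal K / ?N)"
            by (rule mult_left_mono[OF dual]) simp
          also have "\<dots> = ennreal (E * K * F) / ?N"
            using E F K by (simp add: ennreal_times_divide ennreal_mult[symmetric] ac_simps)
          finally show ?thesis unfolding eq by (rule add_increasing[rotated]) simp
        qed
      qed simp
    qed
  qed
qed

section \<open>The kernel of the Riesz potential\<close>

lemma powr_between:
  assumes "0 < (v::real)" "0 \<le> b" "b \<le> 1"
  shows "min 1 v \<le> v powr b" "v powr b \<le> max 1 v"
proof -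
  have "min 1 v \<le> v powr b \<and> v powr b \<le> max 1 v"
  proof (cases "v \<le> 1")
    case True
    then show ?thesis
      using assms powr_mono'[of b 1 v] powr_mono'[of 0 b v] by simp
  next
    case False
    then show ?thesis
      using assms powr_mono[of b 1 v] powr_mono[of 0 b v] by simp
  qed
  then show "min 1 v \<le> v powr b" "v powr b \<le> max 1 v" by auto
qed

lemma riesz_kernel_nonneg: "0 \<le> riesz_kernel \<alpha> x y"
  by (simp add: riesz_kernel_def)

text \<open>Up to a bounded power of the volume of the unit ball, the kernel at \<open>(x, y)\<close> is the reciprocal of the
  fractional volume of the ball with centre \<open>x\<close> and radius \<open>|x - y|\<close>.  For \<open>x\<close> near \<open>c\<close> and \<open>y\<close> far away, this ball and
  the one with centre \<open>c\<close> and radius \<open>|c - y|\<close> both lie in the ball with centre \<open>c\<close> and radius \<open>2 |c - y|\<close>, and their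
  radii are at least a quarter of that.\<close>

lemma riesz_kernel_comparable:
  fixes \<alpha> :: "'a::euclidean_space \<Rightarrow> real"
  assumes a: "\<forall>x. 0 \<le> \<alpha> x \<and> \<alpha> x \<le> 1" and v: "(\<lambda>x. inverse (ennreal (\<alpha> x))) \<in> var_exponents"
    and A: "A_const (\<lambda>x. inverse (ennreal (\<alpha> x))) < \<infinity>"
  obtains C where "0 < C"
    "\<And>(c :: 'a) R x y. 0 < R \<Longrightarrow> x \<in> ball c R \<Longrightarrow> y \<notin> ball c (2 * R) \<Longrightarrow>
      riesz_kernel \<alpha> x y \<le> C * riesz_kernel \<alpha> c y \<and> riesz_kernel \<alpha> c y \<le> C * riesz_kernel \<alpha> x y"
proof -
  define U where "U B = vol B powr (1 - average \<alpha> B)" for B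
  obtain E where E: "0 < E" "\<And>(c :: 'a) R c' R'. 0 < R \<Longrightarrow> ball c R \<subseteq> ball c' R' \<Longrightarrow> R' \<le> 4 * R \<Longrightarrow>
      U (ball c R) \<le> E * U (ball c' R') \<and> U (ball c' R') \<le> E * U (ball c R)"
    using fractional_volume_comparable[OF a v A, of 4] unfolding U_def by (metis one_le_numeral)
  define v where "v = unit_ball_vol (real DIM('a))"
  have v: "0 < v" by (simp add: v_def)
  define m M where "m = min 1 v" and "M = max 1 v"
  have mM: "0 < m" "0 < M" using v by (auto simp: m_def M_def)
  have \<alpha>_m: "\<alpha> \<in> borel_measurable lebesgue"
    by (rule alpha_as_exponent(1)[OF a assms(2)])
  have k: "m / U (ball x (dist x y)) \<le> riesz_kernel \<alpha> x y \<and> riesz_kernel \<alpha> x y \<le> M / U (ball x (dist x y))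
      \<and> 0 < U (ball x (dist x y))" if "x \<noteq> y" for x y
  proof -
    define \<rho> where "\<rho> = dist x y"
    define b where "b = 1 - average \<alpha> (ball x \<rho>)"
    have \<rho>: "0 < \<rho>" using that by (simp add: \<rho>_def)
    have b: "0 \<le> b" "b \<le> 1"
      using average_bounds[OF \<alpha>_m _ _ \<rho>, of x] a by (auto simp: b_def)
    have "U (ball x \<rho>) = (v * \<rho> ^ DIM('a)) powr b"
      unfolding U_def b_def[symmetric] vol_ball[OF \<rho>] v_def by (rule refl)
    also have "\<dots> = v powr b * \<rho> powr (real DIM('a) * b)"
      using \<rho> v by (simp add: powr_mult powr_powr powr_realpow[symmetric])
    finally have U: "U (ball x \<rho>) = v powr b * \<rho> powr (real DIM('a) * b)" .
    then have "riesz_kernel \<alpha> x y = v powr b / U (ball x \<rho>)"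
      using v by (simp add: riesz_kernel_def \<rho>_def[unfolded dist_norm, symmetric] b_def[symmetric])
    moreover have "0 < U (ball x \<rho>)" using U v \<rho> by simp
    ultimately show ?thesis
      using powr_between[OF v b] unfolding m_def M_def \<rho>_def[symmetric] by (simp add: divide_right_mono)
  qed
  \<comment> \<open>Two comparisons, through the common large ball, give \<open>E\<^sup>2\<close>; passing from the kernel to the volume and back gives \<open>M / m\<close>.\<close>
  define C where "C = M * E\<^sup>2 / m"
  show ?thesis
  proof (rule that[of C])
    show "0 < C" using mM E by (simp add: C_def)
    fix c x y :: 'a and R :: real assume R: "0 < R" "x \<in> ball c R" "y \<notin> ball c (2 * R)"
    define \<rho> \<rho>' where "\<rho> = dist c y" and "\<rho>' = dist x y"
    have d: "dist c x \<le> \<rho> / 2" "0 < \<rho>" using R by (auto simp: \<rho>_def)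
    have \<rho>': "\<rho> / 2 \<le> \<rho>'" "\<rho>' \<le> 3 / 2 * \<rho>"
      using d dist_triangle[of c y x] dist_triangle[of x y c] by (auto simp: \<rho>_def \<rho>'_def dist_commute)
    have ne: "c \<noteq> y" "x \<noteq> y" using d \<rho>' by (auto simp: \<rho>_def \<rho>'_def)
    have sub: "ball x \<rho>' \<subseteq> ball c (2 * \<rho>)" "ball c \<rho> \<subseteq> ball c (2 * \<rho>)"
    proof
      fix z assume "z \<in> ball x \<rho>'"
      then show "z \<in> ball c (2 * \<rho>)"
        using d \<rho>' dist_triangle[of c z x] by simp
    qed (use d in auto)
    have Ux: "U (ball x \<rho>') \<le> E * U (ball c (2 * \<rho>))" "U (ball c (2 * \<rho>)) \<le> E * U (ball x \<rho>')"
      using E(2)[OF _ sub(1)] d \<rho>' by auto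
    have Uc: "U (ball c \<rho>) \<le> E * U (ball c (2 * \<rho>))" "U (ball c (2 * \<rho>)) \<le> E * U (ball c \<rho>)"
      using E(2)[OF _ sub(2)] d by auto
    have UU: "U (ball x \<rho>') \<le> E\<^sup>2 * U (ball c \<rho>)" "U (ball c \<rho>) \<le> E\<^sup>2 * U (ball x \<rho>')"
      using order_trans[OF Ux(1) mult_left_mono[OF Uc(2) less_imp_le[OF E(1)]]]
        order_trans[OF Uc(1) mult_left_mono[OF Ux(2) less_imp_le[OF E(1)]]]
      by (simp_all only: power2_eq_square mult.assoc)
    have kk: "s \<le> C * t" if "s \<le> M / u" "m / w \<le> t" "w \<le> E\<^sup>2 * u" "0 < u" "0 < w" for s t u w
    proof -
      have "1 / u \<le> E\<^sup>2 / w" using that by (simp add: field_simps)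
      then have "M / u \<le> C * (m / w)"
        using mM mult_left_mono[of "1 / u" "E\<^sup>2 / w" M] by (simp add: C_def)
      also have "\<dots> \<le> C * t" using that \<open>0 < C\<close> by (intro mult_left_mono) auto
      finally show ?thesis using that by simp
    qed
    show "riesz_kernel \<alpha> x y \<le> C * riesz_kernel \<alpha> c y \<and> riesz_kernel \<alpha> c y \<le> C * riesz_kernel \<alpha> x y"
      using k[OF ne(1), folded \<rho>_def] k[OF ne(2), folded \<rho>'_def] UU kk by blast
  qed
qed

lemma riesz_kernel_AE_cong:
  fixes \<alpha> \<beta> :: "'a::euclidean_space \<Rightarrow> real"
  assumes [measurable]: "\<alpha> \<in> borel_measurable lebesgue" "\<beta> \<in> borel_measurable lebesgue"
    and "AE x in lebesgue. \<alpha> x = \<beta> x"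
  shows "riesz_kernel \<alpha> = riesz_kernel \<beta>"
proof -
  have "average \<alpha> (ball c R) = average \<beta> (ball c R)" for c R
    unfolding average_def set_lebesgue_integral_def
    by (intro arg_cong2[where f = "(/)"] integral_cong_AE) (use assms(3) in \<open>auto elim: eventually_mono\<close>)
  then show ?thesis by (simp add: riesz_kernel_def[abs_def])
qed

text \<open>The averages do not change if \<open>\<alpha>\<close> is modified on a null set.  For a Borel representative the average
  over \<open>ball x |x - y|\<close> is a parameter integral of a function that is Borel in all three variables.\<close>

lemma riesz_kernel_measurable_pair:
  fixes \<alpha> :: "'a::euclidean_space \<Rightarrow> real"
  assumes \<alpha>: "\<alpha> \<in> borel_measurable lebesgue"
  shows "(\<lambda>(x, y). riesz_kernel \<alpha> x y) \<in> borel_measurable (borel \<Otimes>\<^sub>M borel)"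
proof -
  obtain \<beta> where \<beta>: "\<beta> \<in> borel_measurable lborel" and eq: "AE x in lborel. \<alpha> x = \<beta> x"
    using completion_ex_borel_measurable_real[OF \<alpha>] by blast
  have [measurable]: "\<beta> \<in> borel_measurable borel" using \<beta> by simp
  have "riesz_kernel \<alpha> = riesz_kernel \<beta>"
    using \<alpha> measurable_completion[OF \<beta>] AE_completion[OF eq] by (rule riesz_kernel_AE_cong)
  moreover have "average \<beta> (ball x (norm (x - y)))
      = (\<integral>z. indicator {z. dist x z < dist x y} z *\<^sub>R \<beta> z \<partial>lborel) / (unit_ball_vol (real DIM('a)) * dist x y ^ DIM('a))" for x y
  proof -
    have "(LINT z:ball x (norm (x - y))|lebesgue. \<beta> z) = (\<integral>z. indicator {z. dist x z < dist x y} z *\<^sub>R \<beta> z \<partial>lborel)"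
      unfolding set_lebesgue_integral_def
      by (subst integral_completion) (auto simp: ball_def dist_norm)
    moreover have "vol (ball x (norm (x - y))) = unit_ball_vol (real DIM('a)) * dist x y ^ DIM('a)"
      by (simp add: content_ball dist_norm)
    ultimately show ?thesis by (simp add: average_def)
  qed
  moreover have "(\<lambda>(x, y). 1 / norm (x - y) powr (real DIM('a) * (1 -
      (\<integral>z. indicator {z. dist x z < dist x y} z *\<^sub>R \<beta> z \<partial>lborel) / (unit_ball_vol (real DIM('a)) * dist x y ^ DIM('a)))))
      \<in> borel_measurable (borel \<Otimes>\<^sub>M borel)"
    by measurable
  ultimately show ?thesis by (simp add: riesz_kernel_def[abs_def])
qed

lemma riesz_kernel_measurable [measurable (raw)]:
  fixes \<alpha> :: "'a::euclidean_space \<Rightarrow> real"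
  assumes "\<alpha> \<in> borel_measurable lebesgue"
  shows "riesz_kernel \<alpha> x \<in> borel_measurable lebesgue"
proof -
  have "(\<lambda>y. riesz_kernel \<alpha> x y) \<in> borel_measurable borel"
    using measurable_compose[OF measurable_Pair1'[of x borel borel] riesz_kernel_measurable_pair[OF assms]] by simp
  then show ?thesis by (intro measurable_completion) simp
qed

lemma complex_borel_representative:
  fixes f :: "'a::euclidean_space \<Rightarrow> complex"
  assumes "f \<in> borel_measurable lebesgue"
  obtains g where "g \<in> borel_measurable borel" "AE x in lebesgue. f x = g x"
proof -
  have "(\<lambda>x. Re (f x)) \<in> borel_measurable lebesgue" "(\<lambda>x. Im (f x)) \<in> borel_measurable lebesgue"
    using assms by (simp_all add: borel_measurable_complex_iff)
  then obtain u v where uv: "u \<in> borel_measurable lborel" "v \<in> borel_measurable lborel"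
    and ae: "AE x in lborel. Re (f x) = u x" "AE x in lborel. Im (f x) = v x"
    using completion_ex_borel_measurable_real by metis
  show ?thesis
  proof (rule that[of "\<lambda>x. Complex (u x) (v x)"])
    show "(\<lambda>x. Complex (u x) (v x)) \<in> borel_measurable borel"
      using uv by (simp add: borel_measurable_complex_iff)
    have "AE x in lborel. f x = Complex (u x) (v x)"
      using ae by eventually_elim (auto simp: complex_eq_iff)
    then show "AE x in lebesgue. f x = Complex (u x) (v x)" by (rule AE_completion)
  qed
qed

text \<open>The integral defining the potential only depends on the class of \<open>f\<close> modulo null sets, so \<open>f\<close> may be
  replaced by a Borel representative; then both the set of convergence and the value of the integral
  depend measurably on \<open>x\<close>.\<close>

lemma riesz_op_measurable:
  fixes \<alpha> :: "'a::euclidean_space \<Rightarrow> real"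
  assumes \<alpha>: "\<alpha> \<in> borel_measurable lebesgue" and f [measurable]: "f \<in> borel_measurable lebesgue"
  shows "riesz_op \<alpha> f \<in> borel_measurable lebesgue"
proof -
  obtain g where g: "g \<in> borel_measurable borel" and fg: "AE x in lebesgue. f x = g x"
    using complex_borel_representative[OF f] .
  note [measurable] = g riesz_kernel_measurable[OF \<alpha>]
  define H where "H x y = indicator (UNIV - {x}) y *\<^sub>R (riesz_kernel \<alpha> x y *\<^sub>R g y)" for x y
  have "(\<lambda>(x, y). (if x = y then 0 else 1 :: real) *\<^sub>R (riesz_kernel \<alpha> x y *\<^sub>R g y)) \<in> borel_measurable (borel \<Otimes>\<^sub>M borel)"
    using riesz_kernel_measurable_pair[OF \<alpha>] by (auto simp: case_prod_beta' intro!: borel_measurable_scaleR)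
  moreover have "(\<lambda>(x, y). (if x = y then 0 else 1 :: real) *\<^sub>R (riesz_kernel \<alpha> x y *\<^sub>R g y)) = (\<lambda>(x, y). H x y)"
    by (auto simp: H_def indicator_def)
  ultimately have H [measurable]: "(\<lambda>(x, y). H x y) \<in> borel_measurable (borel \<Otimes>\<^sub>M borel)"
    by simp
  have Hx [measurable]: "H x \<in> borel_measurable borel" for x
    using measurable_compose[OF measurable_Pair1'[of x borel borel] H] by simp
  have g' [measurable]: "g \<in> borel_measurable lebesgue"
    by (intro measurable_completion) simp
  have cong: "AE y in lebesgue. indicator (UNIV - {x}) y *\<^sub>R (riesz_kernel \<alpha> x y *\<^sub>R f y) = H x y" for x
    using fg by eventually_elim (simp add: H_def)
  have [measurable]: "UNIV - {x} \<in> sets lebesgue" for x :: 'a by simp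
  have m: "(\<lambda>y. indicator (UNIV - {x}) y *\<^sub>R (riesz_kernel \<alpha> x y *\<^sub>R f y)) \<in> borel_measurable lebesgue" for x
    by measurable
  have Hl: "H x \<in> borel_measurable lebesgue" for x
    by (intro measurable_completion) simp
  have eq: "riesz_op \<alpha> f x = (if integrable lborel (H x) then ennreal (norm (\<integral>y. H x y \<partial>lborel)) else \<infinity>)" for x
  proof -
    have "set_integrable lebesgue (UNIV - {x}) (\<lambda>y. riesz_kernel \<alpha> x y *\<^sub>R f y) \<longleftrightarrow> integrable lborel (H x)"
      unfolding set_integrable_def integrable_cong_AE[OF m Hl cong] by (intro integrable_completion) simp
    moreover have "riesz_potential \<alpha> f x = (\<integral>y. H x y \<partial>lborel)"
      unfolding riesz_potential_def set_lebesgue_integral_def integral_cong_AE[OF m Hl cong] by (intro integral_completion) simp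
    ultimately show ?thesis by (simp add: riesz_op_def)
  qed
  have "(\<lambda>x. if integrable lborel (H x) then ennreal (norm (\<integral>y. H x y \<partial>lborel)) else \<infinity>) \<in> borel_measurable borel"
    by measurable
  then show ?thesis
    unfolding eq[abs_def] by (intro measurable_completion) simp
qed

lemma ball_kernel_measurable:
  fixes \<alpha> :: "'a::euclidean_space \<Rightarrow> real"
  assumes "\<alpha> \<in> borel_measurable lebesgue"
  shows "ball_kernel \<alpha> c R \<in> borel_measurable lebesgue"
proof -
  note [measurable] = riesz_kernel_measurable[OF assms]
  have [measurable]: "UNIV - ball c (2 * R) \<in> sets lebesgue"
    by auto
  show ?thesis
    unfolding ball_kernel_def[abs_def] by measurable
qed

section \<open>The Riesz potential\<close>

text \<open>For \<open>f \<ge> 0\<close> nothing cancels in the potential, and for \<open>x\<close> in the ball the kernel at \<open>(x, y)\<close> dominates a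
  multiple of the ball kernel at \<open>y\<close>.  Where the integral diverges the operator has the value \<open>\<infinity>\<close>.\<close>

lemma riesz_testing_if_bounded:
  fixes \<alpha> :: "'a::euclidean_space \<Rightarrow> real"
  assumes a: "\<forall>x. 0 \<le> \<alpha> x \<and> \<alpha> x \<le> 1" and v: "(\<lambda>x. inverse (ennreal (\<alpha> x))) \<in> var_exponents"
    and A: "A_const (\<lambda>x. inverse (ennreal (\<alpha> x))) < \<infinity>"
    and bdd: "bounded_op (morrey_norm r p) (morrey_norm s q) (riesz_op \<alpha>)"
  shows "(SUP (c, R)\<in>UNIV \<times> {0<..}. morrey_norm s q (indicator (ball c R))
                 * associate_norm (morrey_norm r p) (ball_kernel \<alpha> c R)) < \<infinity>"
proof -
  obtain C where C: "0 < C" "\<And>(c :: 'a) R x y. 0 < R \<Longrightarrow> x \<in> ball c R \<Longrightarrow> y \<notin> ball c (2 * R) \<Longrightarrow>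
      riesz_kernel \<alpha> c y \<le> C * riesz_kernel \<alpha> x y"
    using riesz_kernel_comparable[OF a v A] by metis
  note \<alpha> = alpha_as_exponent(1)[OF a v]
  note [measurable] = riesz_kernel_measurable[OF \<alpha>]
  have "(SUP i\<in>UNIV \<times> {0<..}. morrey_norm s q (indicator (ball (fst i) (snd i)))
                 * associate_norm (morrey_norm r p) (ball_kernel \<alpha> (fst i) (snd i))) < \<infinity>"
  proof (rule testing_condition_if_bounded[OF bdd C(1)])
    fix i :: "'a \<times> real" and f :: "'a \<Rightarrow> real" and x
    assume i: "i \<in> UNIV \<times> {0<..}" and f [measurable]: "f \<in> borel_measurable lebesgue" and f_nn: "\<And>y. 0 \<le> f y"
      and x: "x \<in> ball (fst i) (snd i)"
    obtain c R where i_eq: "i = (c, R)" by (cases i)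
    have R: "0 < R" using i i_eq by simp
    let ?fc = "\<lambda>y. complex_of_real (f y)"
    let ?h = "\<lambda>y. indicator (UNIV - {x}) y *\<^sub>R (riesz_kernel \<alpha> x y *\<^sub>R ?fc y)"
    show "(\<integral>\<^sup>+y. ennreal (f y) * ball_kernel \<alpha> (fst i) (snd i) y \<partial>lebesgue) \<le> ennreal C * riesz_op \<alpha> ?fc x"
    proof (cases "integrable lebesgue ?h")
      case True
      have pos: "0 \<le> Re (?h y)" for y
        using f_nn by (simp add: riesz_kernel_nonneg)
      have "(\<integral>\<^sup>+y. ennreal (f y) * ball_kernel \<alpha> (fst i) (snd i) y \<partial>lebesgue) \<le> (\<integral>\<^sup>+y. ennreal (C * Re (?h y)) \<partial>lebesgue)"
      proof (rule nn_integral_mono)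
        fix y
        show "ennreal (f y) * ball_kernel \<alpha> (fst i) (snd i) y \<le> ennreal (C * Re (?h y))"
        proof (cases "y \<in> ball c (2 * R)")
          case False
          then have "y \<noteq> x" using x R by (auto simp: i_eq)
          have "f y * riesz_kernel \<alpha> c y \<le> f y * (C * riesz_kernel \<alpha> x y)"
            using C(2)[of R x c y] R x False f_nn by (intro mult_left_mono) (auto simp: i_eq)
          then have "ennreal (f y) * ennreal (riesz_kernel \<alpha> c y) \<le> ennreal (f y * (C * riesz_kernel \<alpha> x y))"
            using f_nn by (simp add: ennreal_mult'[symmetric] riesz_kernel_nonneg ennreal_leI)
          then show ?thesis
            using False \<open>y \<noteq> x\<close> by (simp add: ball_kernel_def i_eq indicator_def ac_simps)
        qed (simp add: ball_kernel_def i_eq)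
      qed
      also have "\<dots> = ennreal (\<integral>y. C * Re (?h y) \<partial>lebesgue)"
        using True pos C(1) by (intro nn_integral_eq_integral integrable_mult_right integrable_Re) auto
      also have "(\<integral>y. C * Re (?h y) \<partial>lebesgue) = C * Re (\<integral>y. ?h y \<partial>lebesgue)"
        by (subst integral_mult_right_zero, subst integral_Re[OF True, symmetric]) simp
      also have "\<dots> \<le> C * norm (\<integral>y. ?h y \<partial>lebesgue)"
        using C(1) complex_Re_le_cmod by (intro mult_left_mono) auto
      also have "ennreal (C * norm (\<integral>y. ?h y \<partial>lebesgue)) = ennreal C * riesz_op \<alpha> ?fc x"
        using True C(1) by (simp add: riesz_op_def riesz_potential_def set_integrable_def set_lebesgue_integral_def ennreal_mult)
      finally show ?thesis by (simp add: ennreal_leI)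
    next
      case False
      then have "riesz_op \<alpha> ?fc x = \<infinity>"
        by (simp add: riesz_op_def set_integrable_def)
      then show ?thesis using C(1) by (simp add: ennreal_mult_top)
    qed
  qed (use \<alpha> in \<open>auto intro: ball_kernel_measurable\<close>)
  then show ?thesis by (simp add: case_prod_beta')
qed

text \<open>The contribution of the part of \<open>f\<close> outside \<open>2B\<^sub>0\<close>, where \<open>B\<^sub>0 = ball c R\<close>, is at most a multiple of the pairing
  of \<open>|f|\<close> with the ball kernel; duality and the testing condition bound it, and in particular show that
  this part of the integral converges absolutely.\<close>

lemma riesz_local_estimate:
  fixes \<alpha> :: "'a::euclidean_space \<Rightarrow> real"
  assumes a: "\<forall>x. 0 \<le> \<alpha> x \<and> \<alpha> x \<le> 1" and v: "(\<lambda>x. inverse (ennreal (\<alpha> x))) \<in> var_exponents"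
    and A: "A_const (\<lambda>x. inverse (ennreal (\<alpha> x))) < \<infinity>"
    and q: "q \<in> var_exponents"
    and test: "(SUP (c, R)\<in>UNIV \<times> {0<..}. morrey_norm s q (indicator (ball c R))
                 * associate_norm (morrey_norm r p) (ball_kernel \<alpha> c R)) < \<infinity>"
  obtains D where "0 \<le> D" "\<And>f F (c :: 'a) R x. f \<in> borel_measurable lebesgue \<Longrightarrow> 0 < F \<Longrightarrow> morrey_norm r p (modulus f) \<le> ennreal F \<Longrightarrow>
      0 < R \<Longrightarrow> x \<in> ball c R \<Longrightarrow>
      riesz_op \<alpha> f x \<le> riesz_op \<alpha> (\<lambda>y. indicator (ball c (2 * R)) y *\<^sub>R f y) x
        + ennreal (D * F) / morrey_norm s q (indicator (ball c R))"
proof -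
  obtain C where C: "0 < C" "\<And>(c :: 'a) R x y. 0 < R \<Longrightarrow> x \<in> ball c R \<Longrightarrow> y \<notin> ball c (2 * R) \<Longrightarrow>
      riesz_kernel \<alpha> x y \<le> C * riesz_kernel \<alpha> c y"
    using riesz_kernel_comparable[OF a v A] by metis
  note \<alpha> = alpha_as_exponent(1)[OF a v]
  define S where "S = (SUP (c, R)\<in>UNIV \<times> {0<..}. morrey_norm s q (indicator (ball c R))
                 * associate_norm (morrey_norm r p) (ball_kernel \<alpha> c R))"
  obtain K where K: "S = ennreal K" "0 \<le> K"
    using test unfolding S_def[symmetric] by (cases S) auto
  show ?thesis
  proof (rule that[of "C * K"])
    show "0 \<le> C * K" using C K by simp
    fix f :: "'a \<Rightarrow> complex" and F R :: real and c x :: 'a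
    assume f [measurable]: "f \<in> borel_measurable lebesgue" and F: "0 < F" and fF: "morrey_norm r p (modulus f) \<le> ennreal F"
      and R: "0 < R" and x: "x \<in> ball c R"
    note [measurable] = riesz_kernel_measurable[OF \<alpha>] ball_kernel_measurable[OF \<alpha>]
    have [measurable]: "UNIV - {x} \<in> sets lebesgue" "UNIV - ball c (2 * R) \<in> sets lebesgue" by auto
    let ?N = "morrey_norm s q (indicator (ball c R))"
    let ?f2 = "\<lambda>y. indicator (ball c (2 * R)) y *\<^sub>R f y"
    let ?h = "\<lambda>y. indicator (UNIV - {x}) y *\<^sub>R (riesz_kernel \<alpha> x y *\<^sub>R f y)"
    let ?h2 = "\<lambda>y. indicator (UNIV - {x}) y *\<^sub>R (riesz_kernel \<alpha> x y *\<^sub>R ?f2 y)"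
    let ?h3 = "\<lambda>y. indicator (UNIV - ball c (2 * R)) y *\<^sub>R (riesz_kernel \<alpha> x y *\<^sub>R f y)"
    have h: "?h = (\<lambda>y. ?h2 y + ?h3 y)"
      using x R by (auto simp: indicator_def fun_eq_iff)
    have N: "0 < ?N" by (rule morrey_norm_indicator_pos[OF q R])
    have "?N * associate_norm (morrey_norm r p) (ball_kernel \<alpha> c R) \<le> S"
      unfolding S_def using R by (intro SUP_upper2[of "(c, R)"]) auto
    then have dual: "associate_norm (morrey_norm r p) (ball_kernel \<alpha> c R) \<le> ennreal K / ?N"
      unfolding K using N by (rule ennreal_le_divide_if_mult_le)
    have "(\<integral>\<^sup>+y. ennreal (norm (?h3 y)) \<partial>lebesgue) \<le> (\<integral>\<^sup>+y. ennreal C * (modulus f y * ball_kernel \<alpha> c R y) \<partial>lebesgue)"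
    proof (rule nn_integral_mono)
      fix y
      show "ennreal (norm (?h3 y)) \<le> ennreal C * (modulus f y * ball_kernel \<alpha> c R y)"
      proof (cases "y \<in> ball c (2 * R)")
        case False
        then have "riesz_kernel \<alpha> x y * norm (f y) \<le> C * riesz_kernel \<alpha> c y * norm (f y)"
          using C(2)[OF R x False] by (intro mult_right_mono) auto
        then have "ennreal (riesz_kernel \<alpha> x y * norm (f y)) \<le> ennreal C * (modulus f y * ennreal (riesz_kernel \<alpha> c y))"
          using C(1) by (simp add: ennreal_mult[symmetric] riesz_kernel_nonneg ac_simps)
        then show ?thesis using False by (simp add: ball_kernel_def riesz_kernel_nonneg)
      qed simp
    qed
    also have "\<dots> = ennreal C * (\<integral>\<^sup>+y. modulus f y * ball_kernel \<alpha> c R y \<partial>lebesgue)"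
      by (rule nn_integral_cmult) measurable
    also have "\<dots> \<le> ennreal C * (ennreal F * associate_norm (morrey_norm r p) (ball_kernel \<alpha> c R))"
      by (intro mult_left_mono nn_integral_le_associate_norm F fF) auto
    also have "\<dots> \<le> ennreal C * (ennreal F * (ennreal K / ?N))"
      by (intro mult_left_mono dual) auto
    also have "\<dots> = ennreal (C * K * F) / ?N"
      using C F K by (simp add: ennreal_times_divide ennreal_mult[symmetric] ac_simps)
    finally have h3_le: "(\<integral>\<^sup>+y. ennreal (norm (?h3 y)) \<partial>lebesgue) \<le> ennreal (C * K * F) / ?N" .
    also have "\<dots> < \<infinity>"
      using N by (auto simp: less_top[symmetric] ennreal_divide_eq_top_iff)
    finally have h3: "integrable lebesgue ?h3"
      by (intro integrableI_bounded) auto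
    show "riesz_op \<alpha> f x \<le> riesz_op \<alpha> ?f2 x + ennreal (C * K * F) / ?N"
    proof (cases "integrable lebesgue ?h2")
      case True
      have int: "integrable lebesgue ?h"
        unfolding h using True h3 by simp
      have "riesz_op \<alpha> f x = ennreal (norm (integral\<^sup>L lebesgue ?h))"
        using int by (simp add: riesz_op_def riesz_potential_def set_integrable_def set_lebesgue_integral_def)
      also have "integral\<^sup>L lebesgue ?h = integral\<^sup>L lebesgue ?h2 + integral\<^sup>L lebesgue ?h3"
        unfolding h using True h3 by simp
      also have "ennreal (norm \<dots>) \<le> ennreal (norm (integral\<^sup>L lebesgue ?h2)) + ennreal (norm (integral\<^sup>L lebesgue ?h3))"
        unfolding ennreal_plus[OF norm_ge_zero norm_ge_zero, symmetric] by (intro ennreal_leI norm_triangle_ineq)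
      also have "ennreal (norm (integral\<^sup>L lebesgue ?h2)) = riesz_op \<alpha> ?f2 x"
        using True by (simp add: riesz_op_def riesz_potential_def set_integrable_def set_lebesgue_integral_def)
      also have "ennreal (norm (integral\<^sup>L lebesgue ?h3)) \<le> ennreal (C * K * F) / ?N"
        using integral_norm_bound_ennreal[OF h3] h3_le by (rule order_trans)
      finally show ?thesis by (simp add: add_left_mono)
    next
      case False
      then have "riesz_op \<alpha> ?f2 x = \<infinity>"
        by (simp add: riesz_op_def set_integrable_def)
      then show ?thesis by simp
    qed
  qed
qed

theorem theorem4p4:
  fixes p q r s :: "'a::euclidean_space \<Rightarrow> ennreal" and \<alpha> :: "'a \<Rightarrow> real"
  assumes "p \<in> var_exponents" and "q \<in> var_exponents"
    and "r \<in> var_exponents" and "s \<in> var_exponents"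
    and "\<forall>x. 0 \<le> \<alpha> x \<and> \<alpha> x \<le> 1"
    and "(\<lambda>x. inverse (ennreal (\<alpha> x))) \<in> var_exponents"
    and "AE x in lebesgue. recip (p x) - recip (q x) = recip (r x) - recip (s x)"
    and "A_const p + A_const q + A_const r + A_const s
           + A_const (\<lambda>x. inverse (ennreal (\<alpha> x))) < \<infinity>"
  shows "(bounded_op (Lp_norm p) (Lp_norm q) (maximal_op \<alpha>) \<longrightarrow>
           (bounded_op (morrey_norm r p) (morrey_norm s q) (maximal_op \<alpha>) \<longleftrightarrow>
             (SUP B\<in>balls. morrey_norm s q (indicator B)
                 * associate_norm (morrey_norm r p) (indicator B)
                 / ennreal (vol B powr (1 - average \<alpha> B))) < \<infinity>)) \<and>
         (bounded_op (Lp_norm p) (Lp_norm q) (riesz_op \<alpha>) \<longrightarrow>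
           (bounded_op (morrey_norm r p) (morrey_norm s q) (riesz_op \<alpha>) \<longleftrightarrow>
             (SUP (c, R)\<in>UNIV \<times> {0<..}. morrey_norm s q (indicator (ball c R))
                 * associate_norm (morrey_norm r p) (ball_kernel \<alpha> c R)) < \<infinity>))"
proof -
  have A: "A_const p < \<infinity>" "A_const r < \<infinity>" "A_const (\<lambda>x. inverse (ennreal (\<alpha> x))) < \<infinity>"
    using assms(8) by (auto simp: less_top[symmetric])
  note sufficient = morrey_bounded_if_local_estimate[OF assms(1-4,7) A(1,2)]
  have maximal: "bounded_op (morrey_norm r p) (morrey_norm s q) (maximal_op \<alpha>)"
    if "bounded_op (Lp_norm p) (Lp_norm q) (maximal_op \<alpha>)"
      and "(SUP B\<in>balls. morrey_norm s q (indicator B) * associate_norm (morrey_norm r p) (indicator B)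
        / ennreal (vol B powr (1 - average \<alpha> B))) < \<infinity>"
    by (rule maximal_local_estimate[OF assms(5,6) A(3) assms(2) that(2)])
      (rule sufficient[OF that(1) maximal_op_measurable])
  have riesz: "bounded_op (morrey_norm r p) (morrey_norm s q) (riesz_op \<alpha>)"
    if "bounded_op (Lp_norm p) (Lp_norm q) (riesz_op \<alpha>)"
      and "(SUP (c, R)\<in>UNIV \<times> {0<..}. morrey_norm s q (indicator (ball c R))
        * associate_norm (morrey_norm r p) (ball_kernel \<alpha> c R)) < \<infinity>"
    by (rule riesz_local_estimate[OF assms(5,6) A(3) assms(2) that(2)])
      (rule sufficient[OF that(1) riesz_op_measurable[OF alpha_as_exponent(1)[OF assms(5,6)]]])
  show ?thesis
    using maximal riesz maximal_testing_if_bounded[of r p s q \<alpha>] riesz_testing_if_bounded[OF assms(5,6) A(3)]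
    by blast
qed

end
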